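(* Let $X$ be a Tychonoff space that has a coarser separable metrizable topology. The following assertions are equivalent: (1) $C_p(X)$ is strongly sequentially separable and hereditarily sequentially separable; (2) $C_p(X)$ is hereditarily $F$-separable; (3) $C_p(X)$ is hereditarily $\sigma$-separable; (4) $C_p(X)$ is strongly sequentially separable and hereditarily separable; (5) $C_p(X)$ is Fréchet--Urysohn and hereditarily separable; (6) $X$ is a $\gamma$-space and $X^n$ is perfectly normal for every $n\in\mathbb N$; (7) $X$ is a $\gamma$-space and $X^n$ is hereditarily Lindelöf for every $n\in\mathbb N$; (8) $X$ is a $\gamma$-space and $X^\omega$ is perfectly normal; (9) $X$ is a $\gamma$-space and $X^\omega$ is hereditarily Lindelöf; (10) $X$ is a $\gamma$-space and $X^\omega$ is hereditarily normal; (11) $X$ is a $\gamma$-space and $X^\omega$ is hereditarily countably paracompact.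
   Context: $C_p(X)$ denotes the set of all continuous real-valued functions on $X$ with the topology of pointwise convergence. $\mathbb N$ is the set of positive integers; $X^\omega$ is the product of countably infinitely many copies of $X$. "Countable" means at most countable. A space has a property hereditarily if every subspace (with the subspace topology) has that property. For a topological space $Z$ and $A\subseteq Z$, $[A]$ denotes the closure of $A$ in $Z$, and the sequential closure $[A]_s$ is the set of all limits in $Z$ of sequences of points of $A$; $A$ is sequentially dense in $Z$ if $Z=[A]_s$. A space $Z$ is: - sequentially separable if it contains a countable sequentially dense set; - strongly sequentially separable if it is separable and every countable dense subset of $Z$ is sequentially dense in $Z$; - Fréchet--Urysohn if for every $A\subseteq Z$ and $x\in[A]$ there is a sequence in $A$ converging to $x$. The $\sigma$-closure $[A]_\sigma$ of $A\subseteq Z$ is the set of all points $x\in Z$ such that (a) $x\in[A]_s$; and (b) whenever a sequence $\langle x_n\rangle_{n\in\mathbb N}$ of points of $A$ converges to $x$ and $x\in[A\setminus\{x_n:n\in\mathbb N\}]$, there exists a sequence $\langle y_n\rangle_{n\in\mathbb N}$ of points of $A\setminus\{x_n:n\in\mathbb N\}$ converging to $x$. A space $Z$ is $\sigma$-separable if there is a countable $A\subseteq Z$ with $Z=[A]_\sigma$. The $F$-closure $[A]_F$ of $A\subseteq Z$ is the set of all points $x\in[A]$ such that for every $A'\subseteq A$ with $x\in[A']$ there exists a sequence of points of $A'$ converging to $x$. A space $Z$ is $F$-separable if there is a countable $A\subseteq Z$ with $Z=[A]_F$. A cover of a space $X$ is a family of proper subsets of $X$ whose union is $X$; it is open if its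 members are open. An $\omega$-cover is a cover such that each finite subset of $X$ is contained in some member of the cover. A $\gamma$-cover is an infinite cover such that each point of $X$ belongs to all but finitely many members of the cover. $X$ is a $\gamma$-space if every open $\omega$-cover of $X$ has a subfamily that is an open $\gamma$-cover of $X$. *)

theory Defs
  imports "HOL-Analysis.Analysis"
begin

definition tychonoff_space :: "'a topology \<Rightarrow> bool" where
  "tychonoff_space X \<longleftrightarrow> completely_regular_space X \<and> Hausdorff_space X"

definition coarser_topology :: "'a topology \<Rightarrow> 'a topology \<Rightarrow> bool" where
  "coarser_topology Y X \<longleftrightarrow> topspace Y = topspace X \<and> (\<forall>U. openin Y U \<longrightarrow> openin X U)"

text \<open>
  The points of the product are the functions that are extensional on \<open>topspace X\<close>, so every
  continuous real function on \<open>X\<close> is represented exactly once.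
\<close>
definition Cp :: "'a topology \<Rightarrow> ('a \<Rightarrow> real) topology" where
  "Cp X = subtopology (product_topology (\<lambda>_. euclideanreal) (topspace X))
            {f. continuous_map X euclideanreal f}"

definition power_topology :: "'a topology \<Rightarrow> nat \<Rightarrow> (nat \<Rightarrow> 'a) topology" where
  "power_topology X n = product_topology (\<lambda>_. X) {..<n}"

definition omega_power_topology :: "'a topology \<Rightarrow> (nat \<Rightarrow> 'a) topology" where
  "omega_power_topology X = product_topology (\<lambda>_. X) UNIV"

definition seq_closure_of :: "'a topology \<Rightarrow> 'a set \<Rightarrow> 'a set" where
  "seq_closure_of Z A = {x. \<exists>s. (\<forall>n::nat. s n \<in> A) \<and> limitin Z s x sequentially}"

definition sequentially_dense_in :: "'a topology \<Rightarrow> 'a set \<Rightarrow> bool" where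
  "sequentially_dense_in Z A \<longleftrightarrow> A \<subseteq> topspace Z \<and> seq_closure_of Z A = topspace Z"

definition sequentially_separable :: "'a topology \<Rightarrow> bool" where
  "sequentially_separable Z \<longleftrightarrow> (\<exists>A. countable A \<and> sequentially_dense_in Z A)"

definition strongly_sequentially_separable :: "'a topology \<Rightarrow> bool" where
  "strongly_sequentially_separable Z \<longleftrightarrow>
     separable_space Z \<and>
     (\<forall>A. A \<subseteq> topspace Z \<and> countable A \<and> Z closure_of A = topspace Z
          \<longrightarrow> sequentially_dense_in Z A)"

definition frechet_urysohn_space :: "'a topology \<Rightarrow> bool" where
  "frechet_urysohn_space Z \<longleftrightarrow>
     (\<forall>A x. A \<subseteq> topspace Z \<and> x \<in> Z closure_of A
          \<longrightarrow> (\<exists>s. (\<forall>n::nat. s n \<in> A) \<and> limitin Z s x sequentially))"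

definition sigma_closure_of :: "'a topology \<Rightarrow> 'a set \<Rightarrow> 'a set" where
  "sigma_closure_of Z A =
     {x. x \<in> seq_closure_of Z A \<and>
         (\<forall>s. (\<forall>n::nat. s n \<in> A) \<and> limitin Z s x sequentially \<and>
              x \<in> Z closure_of (A - range s)
            \<longrightarrow> (\<exists>t. (\<forall>n::nat. t n \<in> A - range s) \<and> limitin Z t x sequentially))}"

definition sigma_separable :: "'a topology \<Rightarrow> bool" where
  "sigma_separable Z \<longleftrightarrow>
     (\<exists>A. A \<subseteq> topspace Z \<and> countable A \<and> sigma_closure_of Z A = topspace Z)"

definition F_closure_of :: "'a topology \<Rightarrow> 'a set \<Rightarrow> 'a set" where
  "F_closure_of Z A =
     {x. x \<in> Z closure_of A \<and>
         (\<forall>B. B \<subseteq> A \<and> x \<in> Z closure_of B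
            \<longrightarrow> (\<exists>s. (\<forall>n::nat. s n \<in> B) \<and> limitin Z s x sequentially))}"

definition F_separable :: "'a topology \<Rightarrow> bool" where
  "F_separable Z \<longleftrightarrow>
     (\<exists>A. A \<subseteq> topspace Z \<and> countable A \<and> F_closure_of Z A = topspace Z)"

text \<open>Members of a cover are proper subsets; in particular the whole space is never a member.\<close>
definition open_cover :: "'a topology \<Rightarrow> 'a set set \<Rightarrow> bool" where
  "open_cover X \<U> \<longleftrightarrow>
     (\<forall>U\<in>\<U>. openin X U \<and> U \<subset> topspace X) \<and> \<Union>\<U> = topspace X"

definition open_omega_cover :: "'a topology \<Rightarrow> 'a set set \<Rightarrow> bool" where
  "open_omega_cover X \<U> \<longleftrightarrow>
     open_cover X \<U> \<and> (\<forall>F. finite F \<and> F \<subseteq> topspace X \<longrightarrow> (\<exists>U\<in>\<U>. F \<subseteq> U))"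

definition open_gamma_cover :: "'a topology \<Rightarrow> 'a set set \<Rightarrow> bool" where
  "open_gamma_cover X \<U> \<longleftrightarrow>
     open_cover X \<U> \<and> infinite \<U> \<and> (\<forall>x\<in>topspace X. finite {U \<in> \<U>. x \<notin> U})"

definition gamma_space :: "'a topology \<Rightarrow> bool" where
  "gamma_space X \<longleftrightarrow>
     (\<forall>\<U>. open_omega_cover X \<U> \<longrightarrow> (\<exists>\<V>\<subseteq>\<U>. open_gamma_cover X \<V>))"

definition perfectly_normal_space :: "'a topology \<Rightarrow> bool" where
  "perfectly_normal_space X \<longleftrightarrow> normal_space X \<and> (\<forall>C. closedin X C \<longrightarrow> gdelta_in X C)"

text \<open>No separation axiom is included, and covers here may contain the whole space.\<close>
definition countably_paracompact_space :: "'a topology \<Rightarrow> bool" where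
  "countably_paracompact_space X \<longleftrightarrow>
     (\<forall>\<U>. countable \<U> \<and> (\<forall>U\<in>\<U>. openin X U) \<and> \<Union>\<U> = topspace X
        \<longrightarrow> (\<exists>\<V>. (\<forall>V\<in>\<V>. openin X V) \<and> \<Union>\<V> = topspace X \<and>
                 (\<forall>V\<in>\<V>. \<exists>U\<in>\<U>. V \<subseteq> U) \<and> locally_finite_in X \<V>))"

definition all_equivalent :: "bool list \<Rightarrow> bool" where
  "all_equivalent Ps \<longleftrightarrow> (\<forall>P\<in>set Ps. \<forall>Q\<in>set Ps. P \<longleftrightarrow> Q)"

end

theory Submission
  imports Defs
begin

text \<open>
  Write HL for hereditarily Lindelof.  If \<open>X\<^sup>n\<close> is HL for all \<open>n\<close>, applying HL to the sets
  \<open>{x. f (x i) \<in> I i for all i}\<close>, for each tuple of rational intervals \<open>I\<close>, yields countable dense subsets in \<open>Cp X\<close>;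
  conversely, bump functions supported on boxes translate open families in \<open>X\<^sup>n\<close> into subsets of \<open>Cp X\<close>.
  A strongly sequentially separable \<open>Cp X\<close> makes \<open>X\<close> a \<open>\<gamma>\<close>-space: for an \<open>\<omega>\<close>-cover, the functions
  equal to 1 off some member are dense, and a sequence of them converging to 0 selects a \<open>\<gamma>\<close>-subcover.
  Conversely \<open>\<gamma>\<close>-spaces have a Frechet-Urysohn \<open>Cp X\<close> and Lindelof finite powers, so for them
  \<open>X\<^sup>n\<close> is HL as soon as its closed sets are \<open>G\<^sub>\<delta>\<close>.  The latter follows
  from each of the conditions on \<open>X\<^sup>\<omega>\<close>, which contains \<open>X\<^sup>n\<close> times a convergent sequence.
\<close>

text \<open>The obstacle lies between \<open>Cp X\<close> and the powers: a function on
  \<open>X\<close> sees a tuple only through its set of coordinates, so a bump around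
  \<open>x\<close> that is nonzero at every coordinate of \<open>y\<close> need not put
  \<open>y i\<close> near the matching \<open>x i\<close>. The coarser separable metrizable topology
  supplies labels: a countable family of open sets separates the points of every finite set, so the
  points of \<open>X\<^sup>n\<close> fall into countably many pieces, one per tuple of labels, and
  hereditary separability is applied to each piece. Sequences reach covers through strong sequential
  separability, which concerns countable dense sets only; hereditary separability provides a
  countable dense set inside any prescribed dense set. For the conditions on \<sigma>- and
  F-separability no such analysis is made: applied to all subspaces, \<sigma>-separability already
  forces the Frechet-Urysohn property in a T1 space.\<close>

section \<open>Hereditary separability, hereditary Lindelofness and perfect normality\<close>

lemma hereditarily_separable_iff:
  "hereditarily separable_space Z \<longleftrightarrow>
     (\<forall>D\<subseteq>topspace Z. \<exists>C\<subseteq>D. countable C \<and> D \<subseteq> Z closure_of C)"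
proof -
  have "separable_space (subtopology Z D) \<longleftrightarrow> (\<exists>C\<subseteq>D. countable C \<and> D \<subseteq> Z closure_of C)"
    if D: "D \<subseteq> topspace Z" for D
  proof -
    have "subtopology Z D closure_of C = D \<longleftrightarrow> D \<subseteq> Z closure_of C" if "C \<subseteq> D" for C
      using that by (auto simp: closure_of_subtopology Int_absorb1)
    with D show ?thesis
      unfolding separable_space_def topspace_subtopology_subset[OF D] by metis
  qed
  then show ?thesis
    by (simp add: hereditarily_def)
qed

text \<open>Open subspaces suffice: open sets that cover a subset also cover their own union, and a
  countable subfamily with the same union serves both.\<close>

lemma hereditarily_Lindelof_iff:
  "hereditarily Lindelof_space T \<longleftrightarrow>
     (\<forall>\<W>. (\<forall>W\<in>\<W>. openin T W) \<longrightarrow> (\<exists>\<V>\<subseteq>\<W>. countable \<V> \<and> \<Union>\<V> = \<Union>\<W>))"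
  (is "?L \<longleftrightarrow> ?R")
proof
  assume L: ?L
  show ?R
  proof (intro allI impI)
    fix \<W> assume W: "\<forall>W\<in>\<W>. openin T W"
    have sub: "\<Union>\<W> \<subseteq> topspace T"
      using W openin_subset by blast
    have "Lindelof_space (subtopology T (\<Union>\<W>))"
      using L sub by (simp add: hereditarily_def)
    then show "\<exists>\<V>\<subseteq>\<W>. countable \<V> \<and> \<Union>\<V> = \<Union>\<W>"
      unfolding Lindelof_space_subtopology_subset[OF sub]
      by (metis W Union_mono order_refl subset_antisym)
  qed
next
  assume R: ?R
  show ?L
    unfolding hereditarily_def
  proof (intro allI impI)
    fix S assume S: "S \<subseteq> topspace T"
    show "Lindelof_space (subtopology T S)"
      unfolding Lindelof_space_subtopology_subset[OF S]
      using R by metis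
  qed
qed

text \<open>Indices are selected rather than sets, because the applications attach points, functions
  or pairs to the open sets and need them back.\<close>

lemma hereditarily_LindelofD:
  assumes "hereditarily Lindelof_space T" "\<And>i. i \<in> I \<Longrightarrow> openin T (W i)"
  obtains J where "J \<subseteq> I" "countable J" "(\<Union>i\<in>J. W i) = (\<Union>i\<in>I. W i)"
proof -
  obtain \<V> where V: "\<V> \<subseteq> W ` I" "countable \<V>" "\<Union>\<V> = \<Union>(W ` I)"
    using assms unfolding hereditarily_Lindelof_iff by (metis (mono_tags, lifting) image_iff)
  then obtain J where "J \<subseteq> I" "countable J" "\<V> = W ` J"
    by (metis countable_subset_image)
  with V that show ?thesis
    by blast
qed

text \<open>Every open set is a countable union of closed sets, each of which is Lindelof as a
  closed subspace; so open subspaces are Lindelof.\<close>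

lemma Lindelof_perfect_imp_hereditarily_Lindelof:
  assumes L: "Lindelof_space T" and perf: "\<And>C. closedin T C \<Longrightarrow> gdelta_in T C"
  shows "hereditarily Lindelof_space T"
  unfolding hereditarily_Lindelof_iff
proof (intro allI impI)
  fix \<W> assume W: "\<forall>W\<in>\<W>. openin T W"
  have sub: "\<Union>\<W> \<subseteq> topspace T"
    using W openin_subset by blast
  have "gdelta_in T (topspace T - \<Union>\<W>)"
    using W by (intro perf) auto
  then have "fsigma_in T (\<Union>\<W>)"
    using sub by (simp add: fsigma_in_gdelta_in)
  then obtain C where C: "\<And>n::nat. closedin T (C n)" "\<Union>(range C) = \<Union>\<W>"
    unfolding fsigma_in_ascending by metis
  have "Lindelof_space (subtopology T (\<Union>(range C)))"
    using C L by (intro Lindelof_space_Union) (auto intro: Lindelof_space_closedin_subtopology)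
  then have "Lindelof_space (subtopology T (\<Union>\<W>))"
    using C by simp
  then show "\<exists>\<V>\<subseteq>\<W>. countable \<V> \<and> \<Union>\<V> = \<Union>\<W>"
    unfolding Lindelof_space_subtopology_subset[OF sub]
    by (metis W Union_mono order_refl subset_antisym)
qed

lemma hereditarily_imp: "hereditarily P X \<Longrightarrow> P X"
  by (metis hereditarily_def order_refl subtopology_topspace)

lemma hereditarily_hereditarily:
  assumes "hereditarily P X" "S \<subseteq> topspace X"
  shows "hereditarily P (subtopology X S)"
  using assms by (auto simp: hereditarily_def subtopology_subtopology Int_absorb1)

text \<open>Regularity gives each point of \<open>U\<close> a neighbourhood whose closure stays in
  \<open>U\<close>; countably many of these exhaust \<open>U\<close>. Perfect normality and
  countable paracompactness both rest on this decomposition.\<close>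

lemma regular_hereditarily_Lindelof_open:
  assumes reg: "regular_space T" and HL: "hereditarily Lindelof_space T" and U: "openin T U"
  obtains G where "\<And>n::nat. openin T (G n)" "\<And>n. T closure_of G n \<subseteq> U" "(\<Union>n. G n) = U"
proof -
  have "\<exists>V. openin T V \<and> x \<in> V \<and> T closure_of V \<subseteq> U" if x: "x \<in> U" for x
  proof -
    obtain V C where "openin T V" "closedin T C" "x \<in> V" "V \<subseteq> C" "C \<subseteq> U"
      using reg U x unfolding neighbourhood_base_of_closedin[symmetric] neighbourhood_base_of by meson
    then show ?thesis
      by (meson closure_of_minimal order_trans)
  qed
  then obtain V where V: "\<And>x. x \<in> U \<Longrightarrow> openin T (V x) \<and> x \<in> V x \<and> T closure_of V x \<subseteq> U"
    by metis
  obtain J where J: "J \<subseteq> U" "countable J" "(\<Union>x\<in>J. V x) = (\<Union>x\<in>U. V x)"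
    using hereditarily_LindelofD[OF HL, of U V] V by blast
  have VU: "V x \<subseteq> U" if "x \<in> U" for x
    using V[OF that] closure_of_subset openin_subset by (meson order_trans)
  then have J': "(\<Union>x\<in>J. V x) = U"
    unfolding J(3) using V by auto
  show ?thesis
  proof (cases "J = {}")
    case True
    with J' have "U = {}" by simp
    then show ?thesis
      by (intro that[of "\<lambda>_. {}"]) auto
  next
    case False
    have "from_nat_into J n \<in> J" for n
      using False by (rule from_nat_into)
    moreover have "(\<Union>n. V (from_nat_into J n)) = U"
      using range_from_nat_into[OF False J(2)] J'
      by (metis image_image)
    ultimately show ?thesis
      using J(1) V by (intro that[of "\<lambda>n. V (from_nat_into J n)"]) blast+
  qed
qed

lemma regular_hereditarily_Lindelof_imp_perfectly_normal:
  assumes reg: "regular_space T" and HL: "hereditarily Lindelof_space T"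
  shows "perfectly_normal_space T"
  unfolding perfectly_normal_space_def
proof (intro conjI allI impI)
  show "normal_space T"
    using reg hereditarily_imp[OF HL] by (rule regular_Lindelof_imp_normal_space)
  fix C assume C: "closedin T C"
  then have "openin T (topspace T - C)" by blast
  then obtain G where G: "\<And>n::nat. openin T (G n)" "\<And>n. T closure_of G n \<subseteq> topspace T - C"
      "(\<Union>n. G n) = topspace T - C"
    using regular_hereditarily_Lindelof_open[OF reg HL] by metis
  have "G n \<subseteq> T closure_of G n" for n
    using G(1) by (meson closure_of_subset openin_subset)
  then have "(\<Union>n. G n) \<subseteq> (\<Union>n. T closure_of G n)" "(\<Union>n. T closure_of G n) \<subseteq> topspace T - C"
    using G(2) by (auto intro!: UN_mono UN_least)
  then have "(\<Union>n. T closure_of G n) = topspace T - C"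
    using G(3) by auto
  moreover have "fsigma_in T (\<Union>n. T closure_of G n)"
    by (intro fsigma_in_Union) (auto intro: closed_imp_fsigma_in)
  ultimately show "gdelta_in T C"
    using C by (simp add: gdelta_in_fsigma_in closedin_subset)
qed

text \<open>From \<open>u n\<close> the closures of the sets \<open>G i j\<close> with
  \<open>i, j < n\<close> are removed. They lie in earlier members of the cover, so a point survives
  in the first \<open>u n\<close> containing it; and \<open>G n j\<close> is a neighbourhood that
  misses \<open>v m\<close> for all \<open>m\<close> beyond \<open>n\<close> and
  \<open>j\<close>.\<close>

lemma regular_hereditarily_Lindelof_imp_countably_paracompact:
  assumes reg: "regular_space T" and HL: "hereditarily Lindelof_space T"
  shows "countably_paracompact_space T"
  unfolding countably_paracompact_space_def
proof (intro allI impI, elim conjE)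
  fix \<U> assume "countable \<U>" and opn: "\<forall>U\<in>\<U>. openin T U" and cov: "\<Union>\<U> = topspace T"
  show "\<exists>\<V>. (\<forall>V\<in>\<V>. openin T V) \<and> \<Union>\<V> = topspace T \<and> (\<forall>V\<in>\<V>. \<exists>U\<in>\<U>. V \<subseteq> U) \<and> locally_finite_in T \<V>"
  proof (cases "\<U> = {}")
    case True
    then have "topspace T = {}" using cov by simp
    then show ?thesis by (intro exI[of _ "{}"]) (auto simp: locally_finite_in_def)
  next
    case False
    define u where "u \<equiv> from_nat_into \<U>"
    have range_u: "range u = \<U>"
      unfolding u_def by (rule range_from_nat_into[OF False \<open>countable \<U>\<close>])
    have u: "openin T (u n)" for n
      using opn range_u by blast
    have "\<exists>G. (\<forall>j::nat. openin T (G j) \<and> T closure_of G j \<subseteq> u n) \<and> (\<Union>j. G j) = u n" for n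
      using regular_hereditarily_Lindelof_open[OF reg HL u[of n]] by metis
    then obtain G where G: "\<And>n j::nat. openin T (G n j)" "\<And>n j. T closure_of G n j \<subseteq> u n"
        "\<And>n. (\<Union>j. G n j) = u n"
      by metis
    \<comment> \<open>Bounding both indices by \<open>n\<close> keeps the union finite, hence
      closed, while every \<open>G i j\<close> is still absorbed eventually.\<close>
    define F where "F n = (\<Union>i<n. \<Union>j<n. T closure_of G i j)" for n
    define v where "v n = u n - F n" for n
    have F: "closedin T (F n)" for n
      unfolding F_def by (auto intro!: closedin_Union)
    have Fsub: "F n \<subseteq> (\<Union>i<n. u i)" for n
      unfolding F_def using G(2) by blast
    have v: "openin T (v n)" for n
      unfolding v_def using u F by (rule openin_diff)
    have *: "\<Union>(range v) = topspace T"
    proof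
      show "\<Union>(range v) \<subseteq> topspace T"
        using v openin_subset by blast
      show "topspace T \<subseteq> \<Union>(range v)"
      proof
        fix x assume "x \<in> topspace T"
        then have "\<exists>n. x \<in> u n"
          using cov range_u by blast
        then have "x \<in> u (LEAST n. x \<in> u n)" "\<And>i. i < (LEAST n. x \<in> u n) \<Longrightarrow> x \<notin> u i"
          by (auto intro: LeastI dest: not_less_Least)
        then have "x \<in> v (LEAST n. x \<in> u n)"
          unfolding v_def using Fsub by blast
        then show "x \<in> \<Union>(range v)" by blast
      qed
    qed
    have lf: "\<exists>V. openin T V \<and> x \<in> V \<and> finite {U \<in> range v. U \<inter> V \<noteq> {}}"
      if x: "x \<in> topspace T" for x
    proof -
      obtain n j where xG: "x \<in> G n j"
        using x cov range_u G(3) by (metis UN_E)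
      have "v m \<inter> G n j = {}" if "n < m" "j < m" for m
      proof -
        have "G n j \<subseteq> F m"
          using that closure_of_subset[OF openin_subset[OF G(1)[of n j]]] unfolding F_def by blast
        then show ?thesis
          unfolding v_def by blast
      qed
      then have "{U \<in> range v. U \<inter> G n j \<noteq> {}} \<subseteq> v ` {..max n j}"
        by (fastforce simp: not_less[symmetric])
      then show ?thesis
        using G(1) xG by (meson finite_atMost finite_imageI finite_subset)
    qed
    show ?thesis
    proof (intro exI[of _ "range v"] conjI)
      show "\<forall>V\<in>range v. \<exists>U\<in>\<U>. V \<subseteq> U"
        using range_u unfolding v_def by blast
      show "locally_finite_in T (range v)"
        unfolding locally_finite_in_def using * lf by simp
    qed (use v * in auto)
  qed
qed

section \<open>Frechet-Urysohn spaces, \<sigma>-closures and F-closures\<close>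

lemma frechet_urysohn_subtopology:
  assumes "frechet_urysohn_space Z"
  shows "frechet_urysohn_space (subtopology Z S)"
  unfolding frechet_urysohn_space_def
proof (intro allI impI, elim conjE)
  fix A x assume A: "A \<subseteq> topspace (subtopology Z S)" "x \<in> subtopology Z S closure_of A"
  then have x: "x \<in> S" "x \<in> Z closure_of A"
    by (auto simp: closure_of_subtopology Int_absorb1)
  with A obtain s where s: "\<forall>n::nat. s n \<in> A" "limitin Z s x sequentially"
    using assms unfolding frechet_urysohn_space_def by (metis le_inf_iff topspace_subtopology)
  then show "\<exists>s. (\<forall>n::nat. s n \<in> A) \<and> limitin (subtopology Z S) s x sequentially"
    using A(1) x(1) by (intro exI[of _ s]) (auto simp: limitin_subtopology intro: always_eventually)
qed

lemma seq_closure_of_subset_closure_of: "seq_closure_of Z A \<subseteq> Z closure_of A"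
  unfolding seq_closure_of_def limitin_sequentially subset_iff mem_Collect_eq in_closure_of
  by (metis order_refl)

lemma frechet_urysohn_imp_seq_closure_of:
  assumes "frechet_urysohn_space Z" "A \<subseteq> topspace Z"
  shows "seq_closure_of Z A = Z closure_of A"
  using assms seq_closure_of_subset_closure_of[of Z A]
  unfolding frechet_urysohn_space_def seq_closure_of_def by blast

lemma frechet_urysohn_imp_F_closure_of:
  assumes "frechet_urysohn_space Z" "A \<subseteq> topspace Z"
  shows "F_closure_of Z A = Z closure_of A"
  using assms unfolding frechet_urysohn_space_def F_closure_of_def by blast

lemma F_closure_of_subset_sigma_closure_of: "F_closure_of Z A \<subseteq> sigma_closure_of Z A"
  unfolding F_closure_of_def sigma_closure_of_def seq_closure_of_def by blast

lemma sigma_closure_of_subset_seq_closure_of: "sigma_closure_of Z A \<subseteq> seq_closure_of Z A"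
  unfolding sigma_closure_of_def by blast

lemma F_separable_imp_sigma_separable:
  assumes "F_separable Z" shows "sigma_separable Z"
proof -
  have "sigma_closure_of Z A \<subseteq> topspace Z" for A
    using sigma_closure_of_subset_seq_closure_of seq_closure_of_subset_closure_of closure_of_subset_topspace
    by (metis order_trans)
  then show ?thesis
    using assms F_closure_of_subset_sigma_closure_of unfolding F_separable_def sigma_separable_def
    by (metis subset_antisym)
qed

lemma sigma_separable_imp_separable:
  assumes "sigma_separable Z" shows "separable_space Z"
  using assms sigma_closure_of_subset_seq_closure_of seq_closure_of_subset_closure_of closure_of_subset_topspace
  unfolding separable_space_def sigma_separable_def by (metis subset_antisym order_trans)

lemma sequentially_separable_imp_separable:
  assumes "sequentially_separable Z" shows "separable_space Z"
  using assms seq_closure_of_subset_closure_of closure_of_subset_topspace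
  unfolding separable_space_def sequentially_separable_def sequentially_dense_in_def
  by (metis subset_antisym)

lemma frechet_urysohn_separable:
  assumes FU: "frechet_urysohn_space Z" and "separable_space Z"
  shows "strongly_sequentially_separable Z" "sequentially_separable Z" "F_separable Z"
proof -
  obtain C where C: "countable C" "C \<subseteq> topspace Z" "Z closure_of C = topspace Z"
    using assms(2) unfolding separable_space_def by blast
  show "strongly_sequentially_separable Z" "sequentially_separable Z" "F_separable Z"
    using C FU assms(2)
    unfolding strongly_sequentially_separable_def sequentially_separable_def sequentially_dense_in_def
      F_separable_def
    by (metis frechet_urysohn_imp_seq_closure_of frechet_urysohn_imp_F_closure_of)+
qed

text \<open>
  Apply the hypothesis to \<open>A \<union> {x}\<close>. If the countable witness \<open>B\<close> contains \<open>x\<close>, then removing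
  the constant sequence \<open>x\<close> from \<open>B\<close> leaves a set that still has \<open>x\<close> in its closure.
\<close>
lemma hereditarily_sigma_separable_imp_frechet_urysohn:
  assumes t1: "t1_space Z" and H: "hereditarily sigma_separable Z"
  shows "frechet_urysohn_space Z"
  unfolding frechet_urysohn_space_def
proof (intro allI impI, elim conjE)
  fix A x assume A: "A \<subseteq> topspace Z" and x: "x \<in> Z closure_of A"
  show "\<exists>s. (\<forall>n::nat. s n \<in> A) \<and> limitin Z s x sequentially"
  proof (cases "x \<in> A")
    case True
    then show ?thesis using A by (intro exI[of _ "\<lambda>_. x"]) auto
  next
    case False
    have xZ: "x \<in> topspace Z" using x by (simp add: in_closure_of)
    define S where "S = insert x A"
    define Y where "Y = subtopology Z S"
    have S: "S \<subseteq> topspace Z" using A xZ by (simp add: S_def)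
    have Y: "topspace Y = S" unfolding Y_def using S by (simp add: Int_absorb1)
    obtain B where B: "B \<subseteq> S" "sigma_closure_of Y B = S"
      using H S Y unfolding hereditarily_def sigma_separable_def Y_def by metis
    have dense: "S \<subseteq> Y closure_of B"
      using B(2) sigma_closure_of_subset_seq_closure_of[of Y B] seq_closure_of_subset_closure_of[of Y B]
      by simp
    have limY: "limitin Z s y sequentially" if "limitin Y s y sequentially" for s :: "nat \<Rightarrow> _" and y
      using that by (simp add: Y_def limitin_subtopology)
    have xB: "x \<in> sigma_closure_of Y B" using B S_def by simp
    show ?thesis
    proof (cases "x \<in> B")
      case False
      then have "B \<subseteq> A" using B(1) unfolding S_def by blast
      moreover obtain s where "\<forall>n::nat. s n \<in> B" "limitin Y s x sequentially"
        using xB unfolding sigma_closure_of_def seq_closure_of_def by blast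
      ultimately show ?thesis using limY by blast
    next
      case True
      \<comment> \<open>A point \<open>a\<close> of \<open>A\<close> near \<open>x\<close> is itself
        in the closure of \<open>B\<close>. Since \<open>a\<close> differs from \<open>x\<close>, T1
        lets \<open>x\<close> be cut out of the neighbourhood, so the point of \<open>B\<close>
        found near \<open>a\<close> is not \<open>x\<close>.\<close>
      have "x \<in> Y closure_of (B - {x})"
        unfolding in_closure_of
      proof (intro conjI allI impI)
        show "x \<in> topspace Y" using Y S_def by simp
        fix T assume "x \<in> T \<and> openin Y T"
        then obtain U where U: "openin Z U" "T = U \<inter> S" "x \<in> U"
          unfolding Y_def openin_subtopology by blast
        obtain a where a: "a \<in> A" "a \<in> U"
          using x U by (metis in_closure_of)
        have "openin Z (U - {x})"
          using t1 U xZ by (simp add: openin_diff t1_space_closedin_singleton)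
        then have "openin Y ((U - {x}) \<inter> S)"
          unfolding Y_def openin_subtopology by blast
        moreover have "a \<in> (U - {x}) \<inter> S"
          using a \<open>x \<notin> A\<close> S_def by blast
        moreover have "a \<in> Y closure_of B"
          using dense a(1) unfolding S_def by auto
        ultimately have "\<exists>b. b \<in> B \<and> b \<in> (U - {x}) \<inter> S"
          unfolding in_closure_of by meson
        then obtain b where "b \<in> B" "b \<in> (U - {x}) \<inter> S"
          by auto
        then show "\<exists>y. y \<in> B - {x} \<and> y \<in> T"
          using U by blast
      qed
      moreover have "limitin Y (\<lambda>_::nat. x) x sequentially"
        using Y S_def by simp
      moreover have "range (\<lambda>_::nat. x) = {x}" by simp
      ultimately obtain t where "\<forall>n::nat. t n \<in> B - {x}" "limitin Y t x sequentially"
        using xB True unfolding sigma_closure_of_def by fastforce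
      moreover have "B - {x} \<subseteq> A" using B S_def by blast
      ultimately show ?thesis using limY by blast
    qed
  qed
qed

section \<open>Closed sets as \<open>G\<^sub>\<delta>\<close> sets via products with a convergent
  sequence\<close>

text \<open>
  The space \<open>T\<close> contains, via \<open>\<sigma>\<close> and \<open>\<rho>\<close>, a copy of the product of \<open>Z\<close> with a convergent
  sequence, \<open>L k\<close> being the \<open>k\<close>-th level.  Separating the two closed sets \<open>H \<times> \<omega>\<close> and \<open>(Z - H) \<times> {\<omega>}\<close> of the
  product without \<open>H \<times> {\<omega>}\<close>, as in Katetov's theorem, or refining
  the cover by \<open>(Z - H) \<times> (\<omega> + 1)\<close> and the levels, exhibits \<open>H\<close> as a \<open>G\<^sub>\<delta>\<close> set.
\<close>
locale sequence_product =
  fixes Z :: "'z topology" and T :: "'t topology"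
    and \<pi> :: "'t \<Rightarrow> 'z" and \<sigma> :: "nat \<Rightarrow> 'z \<Rightarrow> 't" and \<rho> :: "'z \<Rightarrow> 't" and L :: "nat \<Rightarrow> 't set"
  assumes \<pi>: "continuous_map T Z \<pi>"
    and \<sigma>: "\<And>k. continuous_map Z T (\<sigma> k)" and \<rho>: "\<And>z. z \<in> topspace Z \<Longrightarrow> \<rho> z \<in> topspace T"
    and \<pi>_\<sigma>: "\<And>k z. z \<in> topspace Z \<Longrightarrow> \<pi> (\<sigma> k z) = z"
    and \<pi>_\<rho>: "\<And>z. z \<in> topspace Z \<Longrightarrow> \<pi> (\<rho> z) = z"
    and lim: "\<And>z. z \<in> topspace Z \<Longrightarrow> limitin T (\<lambda>k. \<sigma> k z) (\<rho> z) sequentially"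
    and L: "\<And>k. openin T (L k)"
    and \<sigma>_L: "\<And>j k z. z \<in> topspace Z \<Longrightarrow> \<sigma> j z \<in> L k \<longleftrightarrow> j = k"
    and \<rho>_L: "\<And>k z. z \<in> topspace Z \<Longrightarrow> \<rho> z \<notin> L k"
begin

text \<open>\<open>H\<close> is the intersection of the traces of the single open set
  \<open>U\<close> on the levels, and each trace is open because \<open>\<sigma> k\<close> is
  continuous.\<close>

lemma gdelta_criterion:
  assumes "H \<subseteq> topspace Z" "openin T U" "\<And>k z. z \<in> H \<Longrightarrow> \<sigma> k z \<in> U"
    and "\<And>z. z \<in> topspace Z - H \<Longrightarrow> \<exists>k. \<sigma> k z \<notin> U"
  shows "gdelta_in Z H"
proof -
  have "gdelta_in Z (\<Inter>k. {z \<in> topspace Z. \<sigma> k z \<in> U})"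
    using \<sigma> assms(2)
    by (intro gdelta_in_Inter) (auto intro!: open_imp_gdelta_in openin_continuous_map_preimage)
  moreover have "(\<Inter>k. {z \<in> topspace Z. \<sigma> k z \<in> U}) = H"
  proof
    show "H \<subseteq> (\<Inter>k. {z \<in> topspace Z. \<sigma> k z \<in> U})"
      using assms(1,3) by auto
    show "(\<Inter>k. {z \<in> topspace Z. \<sigma> k z \<in> U}) \<subseteq> H"
    proof
      fix z assume "z \<in> (\<Inter>k. {z \<in> topspace Z. \<sigma> k z \<in> U})"
      then have "z \<in> topspace Z" "\<And>k. \<sigma> k z \<in> U" by auto
      then show "z \<in> H" using assms(4)[of z] by auto
    qed
  qed
  ultimately show ?thesis by simp
qed

text \<open>The copy in \<open>T\<close> of the product with a convergent sequence, without the
  limit points over \<open>H\<close>; the points of \<open>T\<close> outside the copy are dropped as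
  well.\<close>

definition punctured :: "'z set \<Rightarrow> 't set" where
  "punctured H = (\<Union>k. \<sigma> k ` topspace Z) \<union> \<rho> ` (topspace Z - H)"

lemma punctured_subset: "punctured H \<subseteq> topspace T"
  unfolding punctured_def using \<sigma> \<rho> by (auto simp: continuous_map_def)

lemma hereditarily_normal_imp_gdelta:
  assumes N: "hereditarily normal_space T" and H: "closedin Z H"
  shows "gdelta_in Z H"
proof -
  let ?S = "subtopology T (punctured H)"
  have H': "H \<subseteq> topspace Z" using H by (rule closedin_subset)
  \<comment> \<open>\<open>A\<close> consists of the level points over \<open>H\<close>, and
    \<open>B\<close> of the limit points over the complement of \<open>H\<close>. They could meet
    only in limit points over \<open>H\<close>, which \<open>punctured H\<close> lacks.\<close>
  define A where "A = {w \<in> topspace T. \<pi> w \<in> H} \<inter> punctured H"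
  define B where "B = (topspace T - (\<Union>k. L k)) \<inter> punctured H"
  have "closedin ?S A"
    unfolding A_def closedin_subtopology using closedin_continuous_map_preimage[OF \<pi> H] by blast
  moreover have "closedin ?S B"
    unfolding B_def closedin_subtopology using L by (intro exI conjI refl) (auto intro!: closedin_diff)
  moreover have "disjnt A B"
    unfolding A_def B_def punctured_def disjnt_iff using H' by (auto simp: \<sigma>_L \<pi>_\<sigma> \<pi>_\<rho>)
  moreover have "normal_space ?S"
    using N punctured_subset by (simp add: hereditarily_def)
  ultimately obtain U V where UV: "openin ?S U" "openin ?S V" "A \<subseteq> U" "B \<subseteq> V" "disjnt U V"
    unfolding normal_space_def by meson
  then obtain U' V' where U': "openin T U'" "U = U' \<inter> punctured H"
    and V': "openin T V'" "V = V' \<inter> punctured H"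
    unfolding openin_subtopology by blast
  have \<sigma>P: "\<sigma> k z \<in> punctured H" if "z \<in> topspace Z" for k z
    using that by (auto simp: punctured_def)
  show ?thesis
  proof (rule gdelta_criterion[OF H' U'(1)])
    fix k z assume z: "z \<in> H"
    then have "\<sigma> k z \<in> A"
      unfolding A_def using H' \<sigma>P punctured_subset[of H] by (auto simp: \<pi>_\<sigma>)
    then show "\<sigma> k z \<in> U'" using UV U' by blast
  next
    fix z assume z: "z \<in> topspace Z - H"
    then have "\<rho> z \<in> B"
      unfolding B_def punctured_def using \<rho> \<rho>_L by auto
    then have "\<rho> z \<in> V'" using UV V' by blast
    then obtain k where "\<sigma> k z \<in> V'"
      using lim[of z] z V'(1) unfolding limitin_sequentially by blast
    then have "\<sigma> k z \<notin> U'"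
      using UV(5) U'(2) V'(2) \<sigma>P z by (auto simp: disjnt_iff)
    then show "\<exists>k. \<sigma> k z \<notin> U'" ..
  qed
qed

lemma hereditarily_countably_paracompact_imp_gdelta:
  assumes N: "hereditarily countably_paracompact_space T" and H: "closedin Z H"
  shows "gdelta_in Z H"
proof -
  let ?P = "punctured H"
  let ?S = "subtopology T ?P"
  have H': "H \<subseteq> topspace Z" using H by (rule closedin_subset)
  have tS: "topspace ?S = ?P"
    using punctured_subset[of H] by (simp add: Int_absorb1)
  have \<sigma>P: "\<sigma> k z \<in> ?P" if "z \<in> topspace Z" for k z
    using that by (auto simp: punctured_def)
  define W where "W = {w \<in> topspace T. \<pi> w \<in> topspace Z - H} \<inter> ?P"
  define \<U> where "\<U> = insert W (range (\<lambda>k. L k \<inter> ?P))"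
  have "openin T {w \<in> topspace T. \<pi> w \<in> topspace Z - H}"
    using H by (intro openin_continuous_map_preimage[OF \<pi>]) blast
  then have "openin ?S W"
    unfolding W_def openin_subtopology by blast
  then have opn: "\<forall>U\<in>\<U>. openin ?S U"
    unfolding \<U>_def using L by (auto simp: openin_subtopology)
  have "?P \<subseteq> \<Union>\<U>"
  proof
    fix w assume w: "w \<in> ?P"
    then consider k z where "z \<in> topspace Z" "w = \<sigma> k z" | z where "z \<in> topspace Z - H" "w = \<rho> z"
      unfolding punctured_def by blast
    then show "w \<in> \<Union>\<U>"
    proof cases
      case 1
      then have "w \<in> L k \<inter> ?P" using w by (simp add: \<sigma>_L)
      then show ?thesis unfolding \<U>_def by blast
    next
      case 2
      then have "w \<in> W" using w \<rho>[of z] \<pi>_\<rho>[of z] unfolding W_def by simp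
      then show ?thesis unfolding \<U>_def by blast
    qed
  qed
  then have cov: "\<Union>\<U> = topspace ?S"
    using opn openin_subset[of ?S] unfolding tS by (intro subset_antisym Union_least) auto
  have "countable \<U>" unfolding \<U>_def by simp
  then obtain \<V> where V: "\<forall>V\<in>\<V>. openin ?S V" "\<Union>\<V> = ?P" "\<forall>V\<in>\<V>. \<exists>U\<in>\<U>. V \<subseteq> U"
      "locally_finite_in ?S \<V>"
    using N punctured_subset[of H] opn cov tS
    unfolding hereditarily_def countably_paracompact_space_def by metis
  \<comment> \<open>A member of the refinement containing a level point over \<open>H\<close> cannot
    lie in \<open>W\<close>, so it lies in a level; hence \<open>U\<close> contains all level points
    over \<open>H\<close>.\<close>
  define U where "U = \<Union>{V \<in> \<V>. \<exists>k. V \<subseteq> L k}"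
  have "openin ?S U"
    unfolding U_def using V(1) by (intro openin_Union) auto
  then obtain U' where U': "openin T U'" "U = U' \<inter> ?P"
    unfolding openin_subtopology by blast
  show ?thesis
  proof (rule gdelta_criterion[OF H' U'(1)])
    fix k z assume z: "z \<in> H"
    then have zZ: "z \<in> topspace Z" using H' by blast
    then have "\<sigma> k z \<in> \<Union>\<V>" unfolding V(2) by (rule \<sigma>P)
    then obtain V where V': "V \<in> \<V>" "\<sigma> k z \<in> V" by auto
    have "\<sigma> k z \<notin> W" unfolding W_def using z zZ \<pi>_\<sigma> by simp
    moreover obtain U0 where "U0 \<in> \<U>" "V \<subseteq> U0" using V(3) V'(1) by blast
    ultimately have "\<exists>k. V \<subseteq> L k"
      using V'(2) unfolding \<U>_def by auto
    then show "\<sigma> k z \<in> U'" using V' U' unfolding U_def by blast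
  next
    fix z assume z: "z \<in> topspace Z - H"
    then have "\<rho> z \<in> topspace ?S"
      unfolding tS by (auto simp: punctured_def)
    then obtain O1 where O1: "openin ?S O1" "\<rho> z \<in> O1" "finite {V \<in> \<V>. V \<inter> O1 \<noteq> {}}"
      using V(4) unfolding locally_finite_in_def by blast
    then obtain O' where O': "openin T O'" "O1 = O' \<inter> ?P"
      unfolding openin_subtopology by blast
    then obtain N where N: "\<And>k. N \<le> k \<Longrightarrow> \<sigma> k z \<in> O'"
      using lim[of z] z O1(2) unfolding limitin_sequentially by blast
    \<comment> \<open>Otherwise each \<open>\<sigma> k z\<close> lies in a member of the refinement
      confined to one level, so these members are pairwise distinct. Almost all of them meet the
      neighbourhood \<open>O1\<close> of \<open>\<rho> z\<close>, against local finiteness.\<close>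
    have "\<exists>k. \<sigma> k z \<notin> U"
    proof (rule ccontr)
      assume "\<nexists>k. \<sigma> k z \<notin> U"
      then have "\<forall>k. \<exists>V\<in>\<V>. \<sigma> k z \<in> V \<and> (\<exists>j. V \<subseteq> L j)"
        unfolding U_def by blast
      then obtain v where v: "\<And>k. v k \<in> \<V>" "\<And>k. \<sigma> k z \<in> v k" "\<And>k. \<exists>j. v k \<subseteq> L j"
        by metis
      have "inj v"
      proof (rule injI)
        fix i k assume e: "v i = v k"
        obtain j where "v i \<subseteq> L j" using v(3) by blast
        then have "\<sigma> i z \<in> L j" "\<sigma> k z \<in> L j" using v(2) e by blast+
        then show "i = k" using \<sigma>_L z by auto
      qed
      moreover have "v ` {N..} \<subseteq> {V \<in> \<V>. V \<inter> O1 \<noteq> {}}"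
        using v N O' \<sigma>P z by fastforce
      ultimately have "finite {N..}"
        using O1(3) by (meson finite_imageD finite_subset inj_on_subset subset_UNIV)
      then show False by (simp add: infinite_Ici)
    qed
    then show "\<exists>k. \<sigma> k z \<notin> U'"
      using U'(2) \<sigma>P z by auto
  qed
qed

end

section \<open>Finite powers and the countable power of a space\<close>

lemma topspace_power: "topspace (power_topology X n) = ({..<n} \<rightarrow>\<^sub>E topspace X)"
  by (simp add: power_topology_def)

lemma topspace_omega_power:
  "topspace (omega_power_topology X) = {w. \<forall>i. w i \<in> topspace X}"
  by (auto simp: omega_power_topology_def PiE_UNIV_domain)

lemma openin_power_contains_box:
  assumes "openin (power_topology X n) W" "x \<in> W"
  obtains U where "\<forall>i<n. openin X (U i) \<and> x i \<in> U i"
    "({..<n} \<rightarrow>\<^sub>E topspace X) \<inter> {y. \<forall>i<n. y i \<in> U i} \<subseteq> W"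
proof -
  obtain U where "\<forall>i\<in>{..<n}. openin X (U i)" "x \<in> Pi\<^sub>E {..<n} U" "Pi\<^sub>E {..<n} U \<subseteq> W"
    using assms unfolding power_topology_def openin_product_topology_alt by metis
  moreover have "({..<n} \<rightarrow>\<^sub>E topspace X) \<inter> {y. \<forall>i<n. y i \<in> U i} \<subseteq> Pi\<^sub>E {..<n} U"
    by (auto simp: PiE_iff)
  ultimately show ?thesis
    using that[of U] by (auto simp: PiE_iff)
qed

text \<open>Call \<open>U\<close> good if finitely many members of the cover contain the
  \<open>n\<close>-th power of \<open>U\<close>. Good sets capture all finite sets, and the finitely
  many coordinates of a point lie together in almost all members of a \<gamma>-subcover, so
  countably many good sets yield a countable subcover.\<close>

lemma gamma_space_imp_Lindelof_power:
  assumes "gamma_space X"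
  shows "Lindelof_space (power_topology X n)"
  unfolding Lindelof_space_alt topspace_power
proof (intro allI impI, elim conjE)
  fix \<W> assume opn: "\<forall>W\<in>\<W>. openin (power_topology X n) W"
    and cov: "({..<n} \<rightarrow>\<^sub>E topspace X) \<subseteq> \<Union>\<W>"
  define good where "good U \<longleftrightarrow> openin X U \<and> (\<exists>\<G>\<subseteq>\<W>. finite \<G> \<and> ({..<n} \<rightarrow>\<^sub>E U) \<subseteq> \<Union>\<G>)" for U
  have ex_good: "\<exists>U. good U \<and> F \<subseteq> U" if F: "finite F" "F \<subseteq> topspace X" for F
  proof -
    define P where "P = ({..<n} \<rightarrow>\<^sub>E F)"
    have finP: "finite P" unfolding P_def using F by (simp add: finite_PiE)
    have "\<exists>W U. W \<in> \<W> \<and> (\<forall>i<n. openin X (U i) \<and> t i \<in> U i)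
        \<and> ({..<n} \<rightarrow>\<^sub>E topspace X) \<inter> {y. \<forall>i<n. y i \<in> U i} \<subseteq> W" if t: "t \<in> P" for t
    proof -
      have "t \<in> ({..<n} \<rightarrow>\<^sub>E topspace X)"
        using t F(2) unfolding P_def by (auto simp: PiE_iff)
      with cov have "t \<in> \<Union>\<W>" by (rule subsetD)
      then obtain W where W: "W \<in> \<W>" "t \<in> W" by auto
      then have "openin (power_topology X n) W" using opn by blast
      from openin_power_contains_box[OF this W(2)] obtain U where "\<forall>i<n. openin X (U i) \<and> t i \<in> U i"
          "({..<n} \<rightarrow>\<^sub>E topspace X) \<inter> {y. \<forall>i<n. y i \<in> U i} \<subseteq> W" .
      with W(1) show ?thesis by blast
    qed
    then have "\<forall>t\<in>P. \<exists>W U. W \<in> \<W> \<and> (\<forall>i<n. openin X (U i) \<and> t i \<in> U i)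
        \<and> ({..<n} \<rightarrow>\<^sub>E topspace X) \<inter> {y. \<forall>i<n. y i \<in> U i} \<subseteq> W" by blast
    then obtain W U where WU: "\<forall>t\<in>P. W t \<in> \<W> \<and> (\<forall>i<n. openin X (U t i) \<and> t i \<in> U t i)
        \<and> ({..<n} \<rightarrow>\<^sub>E topspace X) \<inter> {y. \<forall>i<n. y i \<in> U t i} \<subseteq> W t"
      unfolding bchoice_iff by blast
    then have W: "\<And>t. t \<in> P \<Longrightarrow> W t \<in> \<W>"
      and U: "\<And>t i. t \<in> P \<Longrightarrow> i < n \<Longrightarrow> openin X (U t i)"
        "\<And>t i. t \<in> P \<Longrightarrow> i < n \<Longrightarrow> t i \<in> U t i"
      and sub: "\<And>t. t \<in> P \<Longrightarrow> ({..<n} \<rightarrow>\<^sub>E topspace X) \<inter> {y. \<forall>i<n. y i \<in> U t i} \<subseteq> W t"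
      by auto
    \<comment> \<open>A neighbourhood of \<open>x\<close> fitting every place where \<open>x\<close>
      occurs as a coordinate of a tuple in \<open>P\<close>. Thus a tuple with entries in these
      neighbourhoods falls into the box of the corresponding tuple of \<open>P\<close>.\<close>
    define N where "N x = topspace X \<inter> \<Inter>((\<lambda>(t, i). U t i) ` {(t, i) \<in> P \<times> {..<n}. t i = x})" for x
    have "openin X (N x)" for x
      unfolding N_def using U finP
      by (intro openin_Int_Inter finite_imageI finite_subset[OF _ finite_cartesian_product[OF finP, of "{..<n}"]]) auto
    then have "openin X (\<Union>(N ` F))" by auto
    moreover have "F \<subseteq> \<Union>(N ` F)"
      using F U(2) unfolding N_def by auto
    moreover have "({..<n} \<rightarrow>\<^sub>E \<Union>(N ` F)) \<subseteq> \<Union>(W ` P)"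
    proof
      fix z assume z: "z \<in> ({..<n} \<rightarrow>\<^sub>E \<Union>(N ` F))"
      then have "\<forall>i\<in>{..<n}. \<exists>x. x \<in> F \<and> z i \<in> N x" by (auto simp: PiE_iff)
      then obtain t where t: "\<And>i. i < n \<Longrightarrow> t i \<in> F \<and> z i \<in> N (t i)"
        by (metis lessThan_iff)
      define t' where "t' = restrict t {..<n}"
      have t': "t' \<in> P" "\<And>i. i < n \<Longrightarrow> z i \<in> N (t' i)"
        unfolding P_def t'_def using t by auto
      have "z i \<in> U t' i \<and> z i \<in> topspace X" if "i < n" for i
        using t'(2)[OF that] t'(1) that unfolding N_def by auto
      then have "z \<in> ({..<n} \<rightarrow>\<^sub>E topspace X) \<inter> {y. \<forall>i<n. y i \<in> U t' i}"
        using z by (auto simp: PiE_iff)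
      with sub[OF t'(1)] have "z \<in> W t'" by (rule subsetD)
      then show "z \<in> \<Union>(W ` P)" using t' by blast
    qed
    moreover have "W ` P \<subseteq> \<W>" "finite (W ` P)" using W finP by auto
    ultimately show ?thesis unfolding good_def by blast
  qed
  show "\<exists>\<V>. countable \<V> \<and> \<V> \<subseteq> \<W> \<and> ({..<n} \<rightarrow>\<^sub>E topspace X) \<subseteq> \<Union>\<V>"
  proof (cases "good (topspace X)")
    \<comment> \<open>Members of an \<omega>-cover must be proper subsets, so a good whole space is
      treated separately; its finite family already covers.\<close>
    case True
    then show ?thesis unfolding good_def by (meson countable_finite)
  next
    case False
    define \<U> where "\<U> = {U. good U}"
    have "\<Union>\<U> = topspace X"
    proof
      show "\<Union>\<U> \<subseteq> topspace X" unfolding \<U>_def good_def using openin_subset by blast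
      show "topspace X \<subseteq> \<Union>\<U>"
      proof
        fix x assume "x \<in> topspace X"
        then show "x \<in> \<Union>\<U>" using ex_good[of "{x}"] unfolding \<U>_def by blast
      qed
    qed
    moreover have "openin X U \<and> U \<subset> topspace X" if "U \<in> \<U>" for U
      using that False openin_subset[of X U] unfolding \<U>_def good_def by auto
    moreover have "\<exists>U\<in>\<U>. F \<subseteq> U" if "finite F" "F \<subseteq> topspace X" for F
      using ex_good[OF that] unfolding \<U>_def by simp
    ultimately have "open_omega_cover X \<U>"
      unfolding open_omega_cover_def open_cover_def by simp
    then obtain \<V> where V: "\<V> \<subseteq> \<U>" "open_gamma_cover X \<V>"
      using assms unfolding gamma_space_def by blast
    \<comment> \<open>Any infinite part of a \<gamma>-cover still captures each finite set; a
      countable one keeps the union of the finite families countable.\<close>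
    obtain \<V>' where V': "\<V>' \<subseteq> \<V>" "countable \<V>'" "infinite \<V>'"
      using V(2) unfolding open_gamma_cover_def by (meson infinite_countable_subset')
    have "good U" if "U \<in> \<V>'" for U
      using that V(1) V'(1) unfolding \<U>_def by auto
    then have "\<exists>\<G>\<subseteq>\<W>. finite \<G> \<and> ({..<n} \<rightarrow>\<^sub>E U) \<subseteq> \<Union>\<G>" if "U \<in> \<V>'" for U
      using that unfolding good_def by simp
    then obtain \<G> where G: "\<And>U. U \<in> \<V>' \<Longrightarrow> \<G> U \<subseteq> \<W>" "\<And>U. U \<in> \<V>' \<Longrightarrow> finite (\<G> U)"
        "\<And>U. U \<in> \<V>' \<Longrightarrow> ({..<n} \<rightarrow>\<^sub>E U) \<subseteq> \<Union>(\<G> U)"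
      by metis
    have "({..<n} \<rightarrow>\<^sub>E topspace X) \<subseteq> \<Union>(\<Union>(\<G> ` \<V>'))"
    proof
      fix z assume z: "z \<in> ({..<n} \<rightarrow>\<^sub>E topspace X)"
      have "finite {U \<in> \<V>. z i \<notin> U}" if "i < n" for i
        using V(2) z that unfolding open_gamma_cover_def by (auto simp: PiE_iff)
      then have "finite (\<Union>i<n. {U \<in> \<V>. z i \<notin> U})" by auto
      then obtain U where U: "U \<in> \<V>'" "U \<notin> (\<Union>i<n. {U \<in> \<V>. z i \<notin> U})"
        using V'(3) by (meson finite_subset subsetI)
      then have "z \<in> ({..<n} \<rightarrow>\<^sub>E U)"
        using z V'(1) by (auto simp: PiE_iff)
      with G(3)[OF U(1)] have "z \<in> \<Union>(\<G> U)" by (rule subsetD)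
      then show "z \<in> \<Union>(\<Union>(\<G> ` \<V>'))" using U(1) by auto
    qed
    moreover have "countable (\<Union>(\<G> ` \<V>'))"
      using G(2) V'(2) by (intro countable_UN) (auto intro: countable_finite)
    moreover have "\<Union>(\<G> ` \<V>') \<subseteq> \<W>" using G(1) by (intro UN_least)
    ultimately show ?thesis by meson
  qed
qed

text \<open>The conditions on powers speak of positive exponents, but
  \<open>hereditarily_separable_Cp\<close> also meets the empty tuple.\<close>

lemma hereditarily_Lindelof_power_0: "hereditarily Lindelof_space (power_topology X 0)"
  unfolding hereditarily_def topspace_power
  by (auto intro!: countable_imp_Lindelof_space simp: topspace_power intro: countable_subset[of _ "{\<lambda>x. undefined}"])

text \<open>Each member of the family is a union of cylinders over finite powers. For each exponent
  countably many bases \<open>V\<close> have the same union as all admissible ones; pairing a base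
  with a member \<open>W\<close> above its cylinder recovers countably many members.\<close>

lemma hereditarily_Lindelof_omega_power:
  assumes HL: "\<And>n. n > 0 \<Longrightarrow> hereditarily Lindelof_space (power_topology X n)"
  shows "hereditarily Lindelof_space (omega_power_topology X)"
  unfolding hereditarily_Lindelof_iff
proof (intro allI impI)
  fix \<W> assume opn: "\<forall>W\<in>\<W>. openin (omega_power_topology X) W"
  define cyl where "cyl n V = {w \<in> topspace (omega_power_topology X). restrict w {..<n} \<in> V}"
    for n and V :: "(nat \<Rightarrow> 'a) set"
  define I where "I n = {(V, W). openin (power_topology X n) V \<and> W \<in> \<W> \<and> cyl n V \<subseteq> W}" for n
  have "\<exists>J\<subseteq>I (Suc n). countable J \<and> (\<Union>i\<in>J. fst i) = (\<Union>i\<in>I (Suc n). fst i)" for n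
    by (rule hereditarily_LindelofD[OF HL[of "Suc n"], of "I (Suc n)" fst])
       (auto simp: I_def)
  then obtain J where J: "\<And>n. J n \<subseteq> I (Suc n)" "\<And>n. countable (J n)"
      "\<And>n. (\<Union>i\<in>J n. fst i) = (\<Union>i\<in>I (Suc n). fst i)"
    by metis
  define \<V> where "\<V> = (\<Union>n. snd ` J n)"
  have "\<V> \<subseteq> \<W>" unfolding \<V>_def using J(1) unfolding I_def by fastforce
  moreover have "countable \<V>" unfolding \<V>_def using J(2) by auto
  moreover have "\<Union>\<W> \<subseteq> \<Union>\<V>"
  proof
    fix w assume "w \<in> \<Union>\<W>"
    then obtain W where W: "W \<in> \<W>" "w \<in> W" by blast
    then have oW: "openin (omega_power_topology X) W" using opn by blast
    then obtain U where U: "finite {i \<in> UNIV. U i \<noteq> topspace X}" "\<forall>i\<in>UNIV. openin X (U i)"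
        "w \<in> Pi\<^sub>E UNIV U" "Pi\<^sub>E UNIV U \<subseteq> W"
      using W(2) unfolding omega_power_topology_def openin_product_topology_alt by blast
    obtain n where n: "\<And>i. U i \<noteq> topspace X \<Longrightarrow> i < Suc n"
      using U(1) unfolding finite_nat_set_iff_bounded by (auto intro: less_SucI)
    define V where "V = Pi\<^sub>E {..<Suc n} U"
    have "openin (power_topology X (Suc n)) V"
      unfolding V_def power_topology_def using U(2) by (simp add: openin_PiE_gen)
    moreover have "cyl (Suc n) V \<subseteq> Pi\<^sub>E UNIV U"
    proof
      fix v assume v: "v \<in> cyl (Suc n) V"
      have "v i \<in> U i" for i
      proof (cases "i < Suc n")
        case True
        then show ?thesis using v unfolding cyl_def V_def by (auto simp: PiE_iff)
      next
        case False
        then show ?thesis using v n[of i] unfolding cyl_def topspace_omega_power by auto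
      qed
      then show "v \<in> Pi\<^sub>E UNIV U" by (simp add: PiE_UNIV_domain)
    qed
    ultimately have "(V, W) \<in> I (Suc n)"
      unfolding I_def using W(1) U(4) by auto
    moreover have wV: "restrict w {..<Suc n} \<in> V"
      unfolding V_def using U(3) by (auto simp: PiE_iff)
    ultimately have "restrict w {..<Suc n} \<in> (\<Union>i\<in>J n. fst i)"
      unfolding J(3) by force
    then obtain V' W' where V': "(V', W') \<in> J n" "restrict w {..<Suc n} \<in> V'" by auto
    then have "w \<in> W'"
      using J(1)[of n] W(2) openin_subset[OF oW] unfolding I_def cyl_def by blast
    then show "w \<in> \<Union>\<V>" unfolding \<V>_def using V'(1) by force
  qed
  ultimately show "\<exists>\<V>\<subseteq>\<W>. countable \<V> \<and> \<Union>\<V> = \<Union>\<W>"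
    by (metis Union_mono subset_antisym)
qed

lemma gdelta_in_continuous_map_preimage:
  assumes "continuous_map S T f" "gdelta_in T H"
  shows "gdelta_in S {x \<in> topspace S. f x \<in> H}"
proof -
  obtain C where C: "\<And>n::nat. openin T (C n)" "\<Inter>(range C) = H"
    using assms(2) unfolding gdelta_in_descending by blast
  have "gdelta_in S (\<Inter>n. {x \<in> topspace S. f x \<in> C n})"
    using assms(1) C(1)
    by (intro gdelta_in_Inter) (auto intro!: open_imp_gdelta_in openin_continuous_map_preimage)
  moreover have "(\<Inter>n. {x \<in> topspace S. f x \<in> C n}) = {x \<in> topspace S. f x \<in> H}"
    using C(2) by auto
  ultimately show ?thesis by simp
qed

text \<open>Handles spaces with at most one point, where a nontrivial convergent sequence or even a
  point to extend tuples by is missing.\<close>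

lemma power_closed_gdelta_trivial:
  assumes "topspace X \<subseteq> {p}" "closedin (power_topology X n) C"
  shows "gdelta_in (power_topology X n) C"
proof -
  have "topspace (power_topology X n) \<subseteq> {\<lambda>i\<in>{..<n}. p}"
    using assms(1) unfolding topspace_power by (force simp: PiE_iff extensional_def fun_eq_iff)
  then have "C = {} \<or> C = topspace (power_topology X n)"
    using closedin_subset[OF assms(2)] by blast
  then show ?thesis by auto
qed

definition prefix_ext :: "nat \<Rightarrow> (nat \<Rightarrow> 'a) \<Rightarrow> (nat \<Rightarrow> 'a) \<Rightarrow> nat \<Rightarrow> 'a" where
  "prefix_ext n e z = (\<lambda>i. if i < n then z i else e i)"

lemma continuous_map_restrict:
  "continuous_map (omega_power_topology X) (power_topology X n) (\<lambda>w. restrict w {..<n})"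
  unfolding omega_power_topology_def power_topology_def continuous_map_componentwise
  by (auto intro: continuous_map_product_projection)

lemma continuous_map_prefix_ext:
  assumes "\<And>i. e i \<in> topspace X"
  shows "continuous_map (power_topology X n) (omega_power_topology X) (prefix_ext n e)"
  unfolding omega_power_topology_def power_topology_def continuous_map_componentwise_UNIV prefix_ext_def
proof
  fix i
  show "continuous_map (product_topology (\<lambda>_. X) {..<n}) X (\<lambda>z. if i < n then z i else e i)"
    using assms by (cases "i < n") (auto intro: continuous_map_product_projection)
qed

text \<open>Appending a constant tail is a continuous section of the restriction map:
  \<open>C\<close> is pulled back to a closed set of the countable power, which is
  \<open>G\<^sub>\<delta>\<close> there, and the section pulls it back to \<open>C\<close>.\<close>

lemma power_closed_gdelta_omega:
  assumes H: "\<And>C. closedin (omega_power_topology X) C \<Longrightarrow> gdelta_in (omega_power_topology X) C"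
    and C: "closedin (power_topology X n) C"
  shows "gdelta_in (power_topology X n) C"
proof (cases "topspace X = {}")
  case True
  then show ?thesis using power_closed_gdelta_trivial[of X undefined n C] C by simp
next
  case False
  then obtain p where p: "p \<in> topspace X" by blast
  let ?C = "{w \<in> topspace (omega_power_topology X). restrict w {..<n} \<in> C}"
  have cm: "continuous_map (power_topology X n) (omega_power_topology X) (prefix_ext n (\<lambda>_. p))"
    using p by (intro continuous_map_prefix_ext)
  have "gdelta_in (power_topology X n) {z \<in> topspace (power_topology X n). prefix_ext n (\<lambda>_. p) z \<in> ?C}"
    by (intro gdelta_in_continuous_map_preimage[OF cm] H closedin_continuous_map_preimage[OF continuous_map_restrict] C)
  moreover have "restrict (prefix_ext n (\<lambda>_. p) z) {..<n} = z" if "z \<in> topspace (power_topology X n)" for z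
    using that unfolding topspace_power prefix_ext_def by (auto simp: fun_eq_iff PiE_iff extensional_def)
  then have "{z \<in> topspace (power_topology X n). prefix_ext n (\<lambda>_. p) z \<in> ?C} = C"
    using closedin_subset[OF C] cm by (auto simp: continuous_map_def)
  ultimately show ?thesis by simp
qed

text \<open>The sequence is made of tails: the \<open>k\<close>-th one is \<open>p\<close> except
  for a single \<open>q\<close> at coordinate \<open>n + k\<close>. This coordinate eventually
  leaves every finite set, so the tails converge to the constant \<open>p\<close>, while a value
  other than \<open>p\<close> at \<open>n + k\<close> singles out the \<open>k\<close>-th
  level.\<close>

lemma sequence_product_omega_power:
  assumes t1: "t1_space X" and p: "p \<in> topspace X" and q: "q \<in> topspace X" "q \<noteq> p"
  shows "sequence_product (power_topology X n) (omega_power_topology X) (\<lambda>w. restrict w {..<n})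
      (\<lambda>k. prefix_ext n (\<lambda>i. if i = n + k then q else p)) (prefix_ext n (\<lambda>_. p))
      (\<lambda>k. {w \<in> topspace (omega_power_topology X). w (n + k) \<in> topspace X - {p}})"
proof
  have r: "restrict (prefix_ext n e z) {..<n} = z" if "z \<in> topspace (power_topology X n)" for e z
    using that unfolding topspace_power prefix_ext_def by (auto simp: fun_eq_iff PiE_iff extensional_def)
  have top: "prefix_ext n e z \<in> topspace (omega_power_topology X)"
    if "z \<in> topspace (power_topology X n)" "\<And>i. e i \<in> topspace X" for e z
    using that unfolding topspace_omega_power topspace_power prefix_ext_def by (auto simp: PiE_iff)
  show "continuous_map (omega_power_topology X) (power_topology X n) (\<lambda>w. restrict w {..<n})"
    by (rule continuous_map_restrict)
  show "continuous_map (power_topology X n) (omega_power_topology X) (prefix_ext n (\<lambda>i. if i = n + k then q else p))" for k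
    using p q by (intro continuous_map_prefix_ext) auto
  fix z assume z: "z \<in> topspace (power_topology X n)"
  show "prefix_ext n (\<lambda>_. p) z \<in> topspace (omega_power_topology X)"
    using z p by (intro top)
  show "restrict (prefix_ext n (\<lambda>i. if i = n + k then q else p) z) {..<n} = z" for k
    using z by (rule r)
  show "restrict (prefix_ext n (\<lambda>_. p) z) {..<n} = z"
    using z by (rule r)
  show "prefix_ext n (\<lambda>i. if i = n + j then q else p) z
      \<in> {w \<in> topspace (omega_power_topology X). w (n + k) \<in> topspace X - {p}} \<longleftrightarrow> j = k" for j k
    using top[OF z, of "\<lambda>i. if i = n + j then q else p"] p q by (auto simp: prefix_ext_def)
  show "prefix_ext n (\<lambda>_. p) z \<notin> {w \<in> topspace (omega_power_topology X). w (n + k) \<in> topspace X - {p}}" for k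
    by (auto simp: prefix_ext_def)
  show "limitin (omega_power_topology X) (\<lambda>k. prefix_ext n (\<lambda>i. if i = n + k then q else p) z)
      (prefix_ext n (\<lambda>_. p) z) sequentially"
    unfolding omega_power_topology_def limitin_componentwise
  proof (intro conjI ballI)
    show "\<forall>\<^sub>F k in sequentially. prefix_ext n (\<lambda>i. if i = n + k then q else p) z \<in> topspace (product_topology (\<lambda>_. X) UNIV)"
      using top[OF z] p q unfolding omega_power_topology_def by (intro always_eventually) auto
    fix i
    have "\<forall>\<^sub>F k in sequentially. prefix_ext n (\<lambda>i. if i = n + k then q else p) z i = prefix_ext n (\<lambda>_. p) z i"
      unfolding eventually_sequentially by (intro exI[of _ "Suc i"]) (auto simp: prefix_ext_def)
    moreover have "prefix_ext n (\<lambda>_. p) z i \<in> topspace X"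
      using top[OF z, of "\<lambda>_. p"] p unfolding topspace_omega_power by auto
    ultimately show "limitin X (\<lambda>k. prefix_ext n (\<lambda>i. if i = n + k then q else p) z i) (prefix_ext n (\<lambda>_. p) z i) sequentially"
      by (intro limitin_eventually)
  qed auto
next
  fix k
  have "openin X (topspace X - {p})"
    using t1 p by (simp add: openin_diff t1_space_closedin_singleton)
  then show "openin (omega_power_topology X) {w \<in> topspace (omega_power_topology X). w (n + k) \<in> topspace X - {p}}"
    unfolding omega_power_topology_def
    by (intro openin_continuous_map_preimage[OF continuous_map_product_projection]) auto
qed

lemma power_closed_gdelta:
  assumes t1: "t1_space X"
    and H: "hereditarily normal_space (omega_power_topology X)
      \<or> hereditarily countably_paracompact_space (omega_power_topology X)"
    and C: "closedin (power_topology X n) C"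
  shows "gdelta_in (power_topology X n) C"
proof (cases "\<exists>p. topspace X \<subseteq> {p}")
  case True
  then show ?thesis using power_closed_gdelta_trivial C by metis
next
  case False
  then obtain p q where "p \<in> topspace X" "q \<in> topspace X" "q \<noteq> p" by blast
  then interpret sequence_product "power_topology X n" "omega_power_topology X" "\<lambda>w. restrict w {..<n}"
      "\<lambda>k. prefix_ext n (\<lambda>i. if i = n + k then q else p)" "prefix_ext n (\<lambda>_. p)"
      "\<lambda>k. {w \<in> topspace (omega_power_topology X). w (n + k) \<in> topspace X - {p}}"
    by (intro sequence_product_omega_power t1)
  show ?thesis
    using H C hereditarily_normal_imp_gdelta hereditarily_countably_paracompact_imp_gdelta by blast
qed

section \<open>Neighbourhoods, limits and bump functions in \<open>Cp X\<close>\<close>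

lemma topspace_Cp: "topspace (Cp X) = {f \<in> extensional (topspace X). continuous_map X euclideanreal f}"
  by (auto simp: Cp_def PiE_iff extensional_def)

lemma restrict_in_Cp:
  assumes "continuous_map X euclideanreal f"
  shows "restrict f (topspace X) \<in> topspace (Cp X)"
  using assms continuous_map_eq[of X euclideanreal f "restrict f (topspace X)"]
  by (simp add: topspace_Cp)

lemma continuous_map_Cp_eval:
  assumes "x \<in> topspace X"
  shows "continuous_map (Cp X) euclideanreal (\<lambda>f. f x)"
  unfolding Cp_def using assms
  by (intro continuous_map_from_subtopology continuous_map_product_projection)

lemma openin_Cp_box:
  assumes F: "finite F" "F \<subseteq> topspace X"
  shows "openin (Cp X) {g \<in> topspace (Cp X). \<forall>x\<in>F. \<bar>g x - f x\<bar> < \<epsilon>}"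
proof -
  have "openin (Cp X) {g \<in> topspace (Cp X). g x \<in> ball (f x) \<epsilon>}" if "x \<in> F" for x
    using that F by (intro openin_continuous_map_preimage[OF continuous_map_Cp_eval]) auto
  then have "openin (Cp X) (topspace (Cp X) \<inter> \<Inter>((\<lambda>x. {g \<in> topspace (Cp X). g x \<in> ball (f x) \<epsilon>}) ` F))"
    using F by (intro openin_Int_Inter) auto
  moreover have "topspace (Cp X) \<inter> \<Inter>((\<lambda>x. {g \<in> topspace (Cp X). g x \<in> ball (f x) \<epsilon>}) ` F)
      = {g \<in> topspace (Cp X). \<forall>x\<in>F. \<bar>g x - f x\<bar> < \<epsilon>}"
    by (auto simp: dist_real_def abs_minus_commute)
  ultimately show ?thesis by simp
qed

lemma openin_Cp_contains_box:
  assumes G: "openin (Cp X) G" "f \<in> G"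
  obtains F \<epsilon> where "finite F" "F \<subseteq> topspace X" "\<epsilon> > 0"
    "{g \<in> topspace (Cp X). \<forall>x\<in>F. \<bar>g x - f x\<bar> < \<epsilon>} \<subseteq> G"
proof -
  obtain S where S: "openin (product_topology (\<lambda>_. euclideanreal) (topspace X)) S"
      "G = S \<inter> {f. continuous_map X euclideanreal f}"
    using G(1) unfolding Cp_def openin_subtopology by blast
  moreover have "f \<in> S" using G(2) S(2) by simp
  ultimately obtain U where U: "finite {x \<in> topspace X. U x \<noteq> UNIV}" "\<forall>x\<in>topspace X. open (U x)"
      "f \<in> Pi\<^sub>E (topspace X) U" "Pi\<^sub>E (topspace X) U \<subseteq> S"
    unfolding openin_product_topology_alt topspace_euclidean open_openin[symmetric] by meson
  define F where "F = {x \<in> topspace X. U x \<noteq> UNIV}"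
  have "\<exists>e>0. ball (f x) e \<subseteq> U x" if "x \<in> F" for x
    using that U(2,3) open_contains_ball unfolding F_def by (metis (mono_tags, lifting) PiE_mem mem_Collect_eq)
  then obtain e where e: "\<And>x. x \<in> F \<Longrightarrow> e x > 0" "\<And>x. x \<in> F \<Longrightarrow> ball (f x) (e x) \<subseteq> U x"
    by metis
  \<comment> \<open>The inserted 1 keeps the minimum defined when no coordinate is
    restricted.\<close>
  define \<epsilon> where "\<epsilon> = Min (insert 1 (e ` F))"
  have finF: "finite F" using U(1) F_def by simp
  show ?thesis
  proof (rule that[of F \<epsilon>])
    show "\<epsilon> > 0" unfolding \<epsilon>_def using finF e(1) by simp
    have \<epsilon>: "\<epsilon> \<le> e x" if "x \<in> F" for x
      unfolding \<epsilon>_def using finF that by simp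
    show "{g \<in> topspace (Cp X). \<forall>x\<in>F. \<bar>g x - f x\<bar> < \<epsilon>} \<subseteq> G"
    proof
      fix g assume g: "g \<in> {g \<in> topspace (Cp X). \<forall>x\<in>F. \<bar>g x - f x\<bar> < \<epsilon>}"
      have "g x \<in> U x" if x: "x \<in> topspace X" for x
      proof (cases "x \<in> F")
        case True
        then have "g x \<in> ball (f x) (e x)"
          using g \<epsilon>[OF True] by (force simp: dist_real_def abs_minus_commute)
        then show ?thesis using e(2)[OF True] by blast
      next
        case False
        then show ?thesis using x F_def by simp
      qed
      then have "g \<in> Pi\<^sub>E (topspace X) U"
        using g by (auto simp: topspace_Cp PiE_iff)
      with U(4) have "g \<in> S" by (rule subsetD)
      then show "g \<in> G" using g S(2) by (auto simp: topspace_Cp)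
    qed
  qed (use finF F_def in auto)
qed

lemma in_Cp_closure_of:
  assumes A: "A \<subseteq> topspace (Cp X)"
  shows "f \<in> Cp X closure_of A \<longleftrightarrow> f \<in> topspace (Cp X) \<and>
    (\<forall>F \<epsilon>. finite F \<and> F \<subseteq> topspace X \<and> \<epsilon> > 0 \<longrightarrow> (\<exists>g\<in>A. \<forall>x\<in>F. \<bar>g x - f x\<bar> < \<epsilon>))"
  (is "_ \<longleftrightarrow> _ \<and> ?R")
proof (intro iffI conjI)
  assume f: "f \<in> Cp X closure_of A"
  then show fC: "f \<in> topspace (Cp X)" by (simp add: in_closure_of)
  show ?R
  proof (intro allI impI, elim conjE)
    fix F and \<epsilon> :: real assume F: "finite F" "F \<subseteq> topspace X" "\<epsilon> > 0"
    have "f \<in> {g \<in> topspace (Cp X). \<forall>x\<in>F. \<bar>g x - f x\<bar> < \<epsilon>}"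
      using fC F(3) by simp
    with f openin_Cp_box[OF F(1,2), of f \<epsilon>]
    have "\<exists>g. g \<in> A \<and> g \<in> {g \<in> topspace (Cp X). \<forall>x\<in>F. \<bar>g x - f x\<bar> < \<epsilon>}"
      unfolding in_closure_of by meson
    then show "\<exists>g\<in>A. \<forall>x\<in>F. \<bar>g x - f x\<bar> < \<epsilon>" by auto
  qed
next
  assume R: "f \<in> topspace (Cp X) \<and> ?R"
  show "f \<in> Cp X closure_of A"
    unfolding in_closure_of
  proof (intro conjI allI impI)
    fix U assume "f \<in> U \<and> openin (Cp X) U"
    then obtain F \<epsilon> where F: "finite F" "F \<subseteq> topspace X" "\<epsilon> > 0"
        "{g \<in> topspace (Cp X). \<forall>x\<in>F. \<bar>g x - f x\<bar> < \<epsilon>} \<subseteq> U"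
      using openin_Cp_contains_box[of X U f] by blast
    then obtain g where "g \<in> A" "\<forall>x\<in>F. \<bar>g x - f x\<bar> < \<epsilon>" using R by metis
    then have "g \<in> A \<and> g \<in> U" using A F(4) by blast
    then show "\<exists>g. g \<in> A \<and> g \<in> U" by blast
  qed (use R in simp)
qed

lemma limitin_Cp:
  "limitin (Cp X) s f sequentially \<longleftrightarrow>
     f \<in> topspace (Cp X) \<and> (\<forall>\<^sub>F n in sequentially. s n \<in> topspace (Cp X)) \<and>
     (\<forall>x\<in>topspace X. (\<lambda>n. s n x) \<longlonglongrightarrow> f x)"
  unfolding Cp_def limitin_subtopology limitin_componentwise
  by (auto simp: PiE_iff eventually_conj_iff)

lemma Hausdorff_Cp: "Hausdorff_space (Cp X)"
  unfolding Cp_def by (intro Hausdorff_space_subtopology) (simp add: Hausdorff_space_product_topology)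

lemma Cp_bump:
  assumes X: "tychonoff_space X" and F: "finite F" "F \<subseteq> U" and U: "openin X U"
  obtains \<phi> where "continuous_map X euclideanreal \<phi>" "\<And>x. x \<in> F \<Longrightarrow> \<phi> x = 1"
    "\<And>x. x \<in> topspace X - U \<Longrightarrow> \<phi> x = 0"
proof -
  have "compactin X F"
    using F openin_subset[OF U] by (intro finite_imp_compactin) auto
  moreover have "closedin X (topspace X - U)" using U by blast
  moreover have "disjnt F (topspace X - U)" using F by (auto simp: disjnt_iff)
  ultimately obtain \<phi> where "continuous_map X euclideanreal \<phi>" "\<phi> ` (topspace X - U) \<subseteq> {0}" "\<phi> ` F \<subseteq> {1}"
    using X unfolding tychonoff_space_def by (metis Urysohn_completely_regular_compact_closed_alt)
  then show ?thesis by (intro that[of \<phi>]) auto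
qed

section \<open>Convergence in \<open>Cp X\<close> and \<gamma>-covers of \<open>X\<close>\<close>

lemma strongly_sequentially_separable_imp_gamma_space:
  assumes X: "tychonoff_space X" and SSS: "strongly_sequentially_separable (Cp X)"
    and HS: "hereditarily separable_space (Cp X)"
  shows "gamma_space X"
  unfolding gamma_space_def
proof (intro allI impI)
  fix \<U> assume om: "open_omega_cover X \<U>"
  have opn: "openin X U" "U \<subset> topspace X" if "U \<in> \<U>" for U
    using om that unfolding open_omega_cover_def open_cover_def by blast+
  define H where "H = {h \<in> topspace (Cp X). \<exists>U\<in>\<U>. \<forall>x\<in>topspace X - U. h x = 1}"
  have HC: "H \<subseteq> topspace (Cp X)" unfolding H_def by blast
  have dense: "topspace (Cp X) \<subseteq> Cp X closure_of H"
  proof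
    fix f assume f: "f \<in> topspace (Cp X)"
    show "f \<in> Cp X closure_of H"
      unfolding in_Cp_closure_of[OF HC]
    proof (intro conjI allI impI f, elim conjE)
      fix F and \<epsilon> :: real assume F: "finite F" "F \<subseteq> topspace X" "\<epsilon> > 0"
      then obtain U where U: "U \<in> \<U>" "F \<subseteq> U"
        using om unfolding open_omega_cover_def by blast
      obtain \<phi> where \<phi>: "continuous_map X euclideanreal \<phi>" "\<And>x. x \<in> F \<Longrightarrow> \<phi> x = 1"
          "\<And>x. x \<in> topspace X - U \<Longrightarrow> \<phi> x = 0"
        using Cp_bump[OF X F(1) U(2) opn(1)[OF U(1)]] by metis
      \<comment> \<open>Interpolates between \<open>f\<close> where \<open>\<phi>\<close> is 1, in
        particular on \<open>F\<close>, and the constant 1 where \<open>\<phi>\<close> is 0, in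
        particular off \<open>U\<close>.\<close>
      define h where "h = restrict (\<lambda>x. f x * \<phi> x + (1 - \<phi> x)) (topspace X)"
      have "h \<in> topspace (Cp X)"
        unfolding h_def using f \<phi>(1)
        by (intro restrict_in_Cp continuous_map_add continuous_map_real_mult continuous_map_diff)
           (auto simp: topspace_Cp)
      then have "h \<in> H" unfolding H_def h_def using U(1) \<phi>(3) by auto
      moreover have "\<forall>x\<in>F. \<bar>h x - f x\<bar> < \<epsilon>"
        unfolding h_def using F \<phi>(2) by auto
      ultimately show "\<exists>g\<in>H. \<forall>x\<in>F. \<bar>g x - f x\<bar> < \<epsilon>" by blast
    qed
  qed
  obtain C where C: "C \<subseteq> H" "countable C" "H \<subseteq> Cp X closure_of C"
    using HS HC unfolding hereditarily_separable_iff by meson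
  have "Cp X closure_of H \<subseteq> Cp X closure_of C"
    using C(3) by (simp add: closure_of_minimal)
  then have "Cp X closure_of C = topspace (Cp X)"
    using dense closure_of_subset_topspace[of "Cp X" C] by auto
  then have "seq_closure_of (Cp X) C = topspace (Cp X)"
    using SSS C HC unfolding strongly_sequentially_separable_def sequentially_dense_in_def
    by (meson order_trans)
  moreover have "restrict (\<lambda>_. 0) (topspace X) \<in> topspace (Cp X)"
    by (intro restrict_in_Cp) auto
  ultimately obtain s where s: "\<And>n::nat. s n \<in> C" "limitin (Cp X) s (restrict (\<lambda>_. 0) (topspace X)) sequentially"
    unfolding seq_closure_of_def by auto
  have "\<exists>U\<in>\<U>. \<forall>x\<in>topspace X - U. s n x = 1" for n
    using s(1)[of n] C(1) unfolding H_def by auto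
  then obtain U where U: "\<And>n. U n \<in> \<U>" "\<And>n x. x \<in> topspace X - U n \<Longrightarrow> s n x = 1"
    by metis
  have fin: "finite {n. x \<notin> U n}" if x: "x \<in> topspace X" for x
  proof -
    have "(\<lambda>n. s n x) \<longlonglongrightarrow> 0" using s(2) x unfolding limitin_Cp by auto
    then have "\<forall>\<^sub>F n in sequentially. s n x < 1" by (rule order_tendstoD) simp
    then obtain N where N: "\<And>n. n \<ge> N \<Longrightarrow> s n x < 1" unfolding eventually_sequentially by blast
    have "{n. x \<notin> U n} \<subseteq> {..<N}"
    proof
      fix n assume "n \<in> {n. x \<notin> U n}"
      then have "s n x = 1" using U(2) x by simp
      then show "n \<in> {..<N}" using N[of n] by (cases "n < N") auto
    qed
    then show ?thesis by (rule finite_subset) simp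
  qed
  show "\<exists>\<V>\<subseteq>\<U>. open_gamma_cover X \<V>"
  proof (intro exI[of _ "range U"] conjI)
    show "range U \<subseteq> \<U>" using U(1) by blast
    show "open_gamma_cover X (range U)"
      unfolding open_gamma_cover_def open_cover_def
    proof (intro conjI ballI)
      fix V assume "V \<in> range U"
      then show "openin X V" "V \<subset> topspace X" using opn U(1) by blast+
    next
      show "\<Union>(range U) = topspace X"
      proof
        show "\<Union>(range U) \<subseteq> topspace X" using opn U(1) by blast
        show "topspace X \<subseteq> \<Union>(range U)"
        proof
          fix x assume "x \<in> topspace X"
          then have "{n. x \<notin> U n} \<noteq> UNIV" using fin by (metis infinite_UNIV_nat)
          then show "x \<in> \<Union>(range U)" by blast
        qed
      qed
    next
      \<comment> \<open>Members of the cover are proper, so a set repeated infinitely often would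
        omit some point at infinitely many indices, contrary to \<open>fin\<close>.\<close>
      show "infinite (range U)"
      proof
        assume f: "finite (range U)"
        have "finite {n. U n = V}" if "V \<in> range U" for V
        proof -
          have "V \<subset> topspace X" using that opn(2) U(1) by auto
          then obtain x where x: "x \<in> topspace X" "x \<notin> V" by auto
          then show ?thesis by (intro finite_subset[OF _ fin[OF x(1)]]) auto
        qed
        then have "finite (\<Union>V\<in>range U. {n. U n = V})" using f by blast
        moreover have "(\<Union>V\<in>range U. {n. U n = V}) = UNIV" by auto
        ultimately show False by simp
      qed
    next
      fix x assume "x \<in> topspace X"
      then show "finite {V \<in> range U. x \<notin> V}"
        by (intro finite_subset[OF _ finite_imageI[OF fin, of x U]]) auto
    qed
  qed
qed

lemma limitin_Cp_inverse_Suc: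
  assumes f: "f \<in> topspace (Cp X)" and s: "\<And>n. s n \<in> topspace (Cp X)"
    and lim: "\<And>x. x \<in> topspace X \<Longrightarrow> \<forall>\<^sub>F n in sequentially. \<bar>s n x - f x\<bar> < inverse (real (Suc n))"
  shows "limitin (Cp X) s f sequentially"
  unfolding limitin_Cp
proof (intro conjI ballI f always_eventually allI s)
  fix x assume "x \<in> topspace X"
  then have "\<forall>\<^sub>F n in sequentially. norm (s n x - f x) \<le> inverse (real (Suc n))"
    using lim[of x] by (auto elim: eventually_mono)
  then have "(\<lambda>n. s n x - f x) \<longlonglongrightarrow> 0"
    by (rule Lim_null_comparison) (rule LIMSEQ_inverse_real_of_nat)
  then show "(\<lambda>n. s n x) \<longlonglongrightarrow> f x" by (simp add: LIM_zero_iff)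
qed

text \<open>
  Removing a point \<open>a n\<close> from every member of the \<open>n\<close>-th \<open>\<omega>\<close>-cover forces each \<open>\<gamma>\<close>-subcover
  of the union of these covers to meet infinitely many of them.
\<close>
lemma gamma_space_imp_frechet_urysohn:
  assumes X: "t1_space X" and \<gamma>: "gamma_space X"
  shows "frechet_urysohn_space (Cp X)"
  unfolding frechet_urysohn_space_def
proof (intro allI impI, elim conjE)
  fix A f assume A: "A \<subseteq> topspace (Cp X)" and f: "f \<in> Cp X closure_of A"
  have fC: "f \<in> topspace (Cp X)"
    and ap: "\<And>F \<epsilon>. finite F \<Longrightarrow> F \<subseteq> topspace X \<Longrightarrow> \<epsilon> > 0 \<Longrightarrow> \<exists>g\<in>A. \<forall>x\<in>F. \<bar>g x - f x\<bar> < \<epsilon>"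
    using f unfolding in_Cp_closure_of[OF A] by auto
  show "\<exists>s. (\<forall>n::nat. s n \<in> A) \<and> limitin (Cp X) s f sequentially"
  proof (cases "finite (topspace X)")
    \<comment> \<open>A finite \<open>X\<close> admits no injective sequence \<open>a\<close>, but
      then approximation on all of \<open>X\<close> gives a convergent sequence directly.\<close>
    case True
    have "\<exists>g\<in>A. \<forall>x\<in>topspace X. \<bar>g x - f x\<bar> < inverse (real (Suc n))" for n
      using ap[OF True order_refl] by simp
    then obtain s where s: "\<And>n. s n \<in> A" "\<And>n x. x \<in> topspace X \<Longrightarrow> \<bar>s n x - f x\<bar> < inverse (real (Suc n))"
      by metis
    have "limitin (Cp X) s f sequentially"
      using s A by (intro limitin_Cp_inverse_Suc[OF fC]) auto
    with s(1) show ?thesis by blast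
  next
    case False
    then obtain a :: "nat \<Rightarrow> 'a" where a: "inj a" "range a \<subseteq> topspace X"
      using infinite_countable_subset by blast
    \<comment> \<open>Removing \<open>a n\<close> also makes every \<open>good n g\<close> a proper
      subset, as membership in a cover demands.\<close>
    define good where "good n g = {x \<in> topspace X. \<bar>g x - f x\<bar> < inverse (real (Suc n))} - {a n}" for n g
    define \<V> where "\<V> = (\<lambda>(n, g). good n g) ` (UNIV \<times> A)"
    have opn: "openin X (good n g)" if "g \<in> A" for n g
    proof -
      have "continuous_map X euclideanreal (\<lambda>x. g x - f x)"
        using that A fC by (intro continuous_map_diff) (auto simp: topspace_Cp)
      then have "openin X {x \<in> topspace X. g x - f x \<in> ball 0 (inverse (real (Suc n)))}"
        by (rule openin_continuous_map_preimage) auto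
      then have "openin X {x \<in> topspace X. \<bar>g x - f x\<bar> < inverse (real (Suc n))}"
        by (simp add: dist_real_def abs_minus_commute)
      then show ?thesis
        unfolding good_def using X a(2) by (intro openin_diff) (auto simp: t1_space_closedin_singleton)
    qed
    have omega: "\<exists>U\<in>\<V>. F \<subseteq> U" if F: "finite F" "F \<subseteq> topspace X" for F
    proof -
      have "\<not> range a \<subseteq> F" using F a(1) by (meson finite_subset range_inj_infinite)
      then obtain n where n: "a n \<notin> F" by blast
      obtain g where "g \<in> A" "\<forall>x\<in>F. \<bar>g x - f x\<bar> < inverse (real (Suc n))"
        using ap[OF F, of "inverse (real (Suc n))"] by auto
      then have "good n g \<in> \<V>" "F \<subseteq> good n g"
        using n F(2) unfolding \<V>_def good_def by auto
      then show ?thesis by blast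
    qed
    have "\<Union>\<V> = topspace X"
    proof
      show "\<Union>\<V> \<subseteq> topspace X" unfolding \<V>_def good_def by auto
      show "topspace X \<subseteq> \<Union>\<V>"
      proof
        fix x assume "x \<in> topspace X"
        then show "x \<in> \<Union>\<V>" using omega[of "{x}"] by auto
      qed
    qed
    moreover have "openin X U \<and> U \<subset> topspace X" if "U \<in> \<V>" for U
      using that opn a(2) unfolding \<V>_def good_def by auto
    ultimately have "open_omega_cover X \<V>"
      unfolding open_omega_cover_def open_cover_def using omega by auto
    then obtain \<W> where W: "\<W> \<subseteq> \<V>" "infinite \<W>" "\<And>x. x \<in> topspace X \<Longrightarrow> finite {U \<in> \<W>. x \<notin> U}"
      using \<gamma> unfolding gamma_space_def open_gamma_cover_def by metis
    \<comment> \<open>Only finitely many members of \<open>\<W>\<close> miss one of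
      \<open>a 0\<close>, ..., \<open>a k\<close>. Any other is some \<open>good n g\<close> with
      \<open>n > k\<close>, because \<open>good n g\<close> omits \<open>a n\<close>.\<close>
    have "\<exists>V n g. V \<in> \<W> \<and> (\<forall>m\<le>k. a m \<in> V) \<and> V = good n g \<and> g \<in> A" for k
    proof -
      have "finite (\<Union>m\<le>k. {U \<in> \<W>. a m \<notin> U})"
        using W(3) a(2) by blast
      then obtain V where V: "V \<in> \<W>" "V \<notin> (\<Union>m\<le>k. {U \<in> \<W>. a m \<notin> U})"
        using W(2) by (meson finite_subset subsetI)
      then obtain n g where "V = good n g" "g \<in> A" using W(1) unfolding \<V>_def by auto
      with V show ?thesis by blast
    qed
    then obtain V n s where V: "\<And>k. V k \<in> \<W>" "\<And>k m. m \<le> k \<Longrightarrow> a m \<in> V k"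
      and s: "\<And>k. V k = good (n k) (s k)" "\<And>k. s k \<in> A"
      by metis
    have n: "a (n k) \<notin> V k" for k
      using s(1) by (simp add: good_def)
    then have nk: "k < n k" for k
      using V(2)[of "n k" k] by (meson not_le)
    \<comment> \<open>\<open>V k\<close> omits \<open>a (n k)\<close>, whereas \<open>V j\<close>
      contains it once \<open>j \<ge> n k\<close>. So each set occurs at finitely many indices, and
      finitely many sets missing \<open>x\<close> mean finitely many such indices.\<close>
    have finV: "finite {k. V k = U}" for U
    proof (cases "\<exists>k. V k = U")
      case True
      then obtain k where k: "V k = U" by blast
      have "j < n k" if "V j = V k" for j
        using n[of k] V(2)[of "n k" j] that by (cases "j < n k") auto
      then have "{j. V j = U} \<subseteq> {..<n k}" using k by auto
      then show ?thesis by (rule finite_subset) simp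
    qed simp
    have "limitin (Cp X) s f sequentially"
    proof (rule limitin_Cp_inverse_Suc[OF fC])
      show "s k \<in> topspace (Cp X)" for k using s(2) A by blast
      fix x assume x: "x \<in> topspace X"
      have "{k. x \<notin> V k} \<subseteq> (\<Union>U\<in>{U \<in> \<W>. x \<notin> U}. {k. V k = U})"
        using V(1) by auto
      moreover have "finite (\<Union>U\<in>{U \<in> \<W>. x \<notin> U}. {k. V k = U})"
        using W(3)[OF x] finV by blast
      ultimately have "finite {k. x \<notin> V k}" by (rule finite_subset)
      then have "\<forall>\<^sub>F k in sequentially. x \<in> V k"
        unfolding cofinite_eq_sequentially[symmetric] eventually_cofinite .
      then show "\<forall>\<^sub>F k in sequentially. \<bar>s k x - f x\<bar> < inverse (real (Suc k))"
      proof (rule eventually_mono)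
        fix k assume "x \<in> V k"
        then have "\<bar>s k x - f x\<bar> < inverse (real (Suc (n k)))"
          using s(1) by (simp add: good_def)
        also have "\<dots> \<le> inverse (real (Suc k))"
          using nk[of k] by (intro le_imp_inverse_le) auto
        finally show "\<bar>s k x - f x\<bar> < inverse (real (Suc k))" .
      qed
    qed
    with s(2) show ?thesis by blast
  qed
qed

section \<open>Hereditary separability of \<open>Cp X\<close> and hereditarily Lindelof
  powers\<close>

lemma hereditarily_separable_Cp:
  assumes HL: "\<And>n. hereditarily Lindelof_space (power_topology X n)"
  shows "hereditarily separable_space (Cp X)"
  unfolding hereditarily_separable_iff
proof (intro allI impI)
  fix D assume D: "D \<subseteq> topspace (Cp X)"
  define I where "I q = {real_of_rat (fst q)<..<real_of_rat (snd q)}" for q :: "rat \<times> rat"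
  \<comment> \<open>Lists of rational pairs encode interval tuples of all lengths; as there are
    countably many, the union of the countable selections \<open>J qs\<close> stays
    countable.\<close>
  define W where "W qs f = {x \<in> topspace (power_topology X (length qs)). \<forall>i<length qs. f (x i) \<in> I (qs ! i)}"
    for qs and f :: "'a \<Rightarrow> real"
  have "openin (power_topology X (length qs)) (W qs f)" if "f \<in> D" for qs f
  proof -
    let ?P = "power_topology X (length qs)"
    have "openin ?P {x \<in> topspace ?P. f (x i) \<in> I (qs ! i)}" if "i < length qs" for i
    proof -
      have "continuous_map ?P X (\<lambda>x. x i)"
        unfolding power_topology_def using that by (intro continuous_map_product_projection) simp
      then have "continuous_map ?P euclideanreal (f \<circ> (\<lambda>x. x i))"
        using D \<open>f \<in> D\<close> by (intro continuous_map_compose) (auto simp: topspace_Cp)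
      from openin_continuous_map_preimage[OF this, of "I (qs ! i)"] show ?thesis
        by (simp add: I_def)
    qed
    then have "openin ?P (topspace ?P \<inter> \<Inter>((\<lambda>i. {x \<in> topspace ?P. f (x i) \<in> I (qs ! i)}) ` {..<length qs}))"
      by (intro openin_Int_Inter) auto
    moreover have "topspace ?P \<inter> \<Inter>((\<lambda>i. {x \<in> topspace ?P. f (x i) \<in> I (qs ! i)}) ` {..<length qs}) = W qs f"
      unfolding W_def by auto
    ultimately show ?thesis by simp
  qed
  then have "\<exists>J\<subseteq>D. countable J \<and> (\<Union>f\<in>J. W qs f) = (\<Union>f\<in>D. W qs f)" for qs
    by (rule hereditarily_LindelofD[OF HL[of "length qs"], of D "W qs"]) auto
  then obtain J where J: "\<And>qs. J qs \<subseteq> D" "\<And>qs. countable (J qs)"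
      "\<And>qs. (\<Union>f\<in>J qs. W qs f) = (\<Union>f\<in>D. W qs f)"
    by metis
  define C where "C = (\<Union>qs. J qs)"
  have CD: "C \<subseteq> D" unfolding C_def using J(1) by blast
  moreover have "countable C" unfolding C_def using J(2) by auto
  moreover have "D \<subseteq> Cp X closure_of C"
  proof
    fix f assume f: "f \<in> D"
    have CC: "C \<subseteq> topspace (Cp X)" using CD D by blast
    show "f \<in> Cp X closure_of C"
      unfolding in_Cp_closure_of[OF CC]
    proof (intro conjI allI impI, goal_cases)
      case 1
      then show ?case using f D by blast
    next
      case (2 F \<epsilon>)
      then have F: "finite F" "F \<subseteq> topspace X" "\<epsilon> > 0" by auto
      obtain xs where xs: "set xs = F" using finite_list[OF F(1)] by blast
      have "\<exists>q. f y \<in> I q \<and> I q \<subseteq> {f y - \<epsilon><..<f y + \<epsilon>}" for y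
      proof -
        obtain a b where "f y - \<epsilon> < real_of_rat a" "real_of_rat a < f y" "f y < real_of_rat b" "real_of_rat b < f y + \<epsilon>"
          using of_rat_dense[of "f y - \<epsilon>" "f y"] of_rat_dense[of "f y" "f y + \<epsilon>"] F(3) by auto
        then show ?thesis by (intro exI[of _ "(a, b)"]) (auto simp: I_def)
      qed
      then obtain q where q: "\<And>y. f y \<in> I (q y)" "\<And>y. I (q y) \<subseteq> {f y - \<epsilon><..<f y + \<epsilon>}"
        by metis
      define x where "x = restrict ((!) xs) {..<length xs}"
      have x: "x \<in> topspace (power_topology X (length (map q xs)))"
        unfolding x_def topspace_power using F(2) xs by (auto simp: nth_mem subset_iff)
      then have "x \<in> W (map q xs) f"
        unfolding W_def using q(1) by (auto simp: x_def)
      \<comment> \<open>The heart of the argument: the tuple enumerating \<open>F\<close> lies in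
        the open set of \<open>f\<close>, hence in that of a selected \<open>g\<close>, whose values
        on \<open>F\<close> then lie in the same small intervals.\<close>
      then have "x \<in> (\<Union>g\<in>J (map q xs). W (map q xs) g)"
        unfolding J(3) using f by blast
      then obtain g where g: "g \<in> J (map q xs)" "x \<in> W (map q xs) g" by blast
      have "\<bar>g y - f y\<bar> < \<epsilon>" if "y \<in> F" for y
      proof -
        have "y \<in> set xs" using that xs by simp
        then obtain i where i: "i < length xs" "y = xs ! i" by (metis in_set_conv_nth)
        then have "g y \<in> I (q y)" using g(2) unfolding W_def x_def by auto
        then show ?thesis using q(2)[of y] by (auto simp: abs_less_iff)
      qed
      then show ?case using g(1) unfolding C_def by blast
    qed
  qed
  ultimately show "\<exists>C\<subseteq>D. countable C \<and> D \<subseteq> Cp X closure_of C" by blast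
qed

text \<open>Small balls around centres taken from a countable dense set separate a finite set. Only
  openness and disjointness are recorded, since these persist in a finer topology.\<close>

lemma separable_metrizable_separating_family:
  assumes "metrizable_space Y" "separable_space Y"
  obtains \<B> where "countable \<B>" "\<And>B. B \<in> \<B> \<Longrightarrow> openin Y B"
    "\<And>F. \<lbrakk>finite F; F \<subseteq> topspace Y\<rbrakk> \<Longrightarrow>
       \<exists>B. (\<forall>x\<in>F. B x \<in> \<B> \<and> x \<in> B x) \<and> (\<forall>x\<in>F. \<forall>y\<in>F. x \<noteq> y \<longrightarrow> disjnt (B x) (B y))"
proof -
  obtain M d where "Metric_space M d" and Y: "Y = Metric_space.mtopology M d"
    using assms(1) unfolding metrizable_space_def by blast
  then interpret Metric_space M d by blast
  obtain C where C: "countable C" "C \<subseteq> M" "mtopology closure_of C = M"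
    using assms(2) unfolding separable_space_def Y by auto
  define \<B> where "\<B> = (\<lambda>(c, k). mball c (inverse (real (Suc k)))) ` (C \<times> UNIV)"
  show ?thesis
  proof (rule that[of \<B>])
    show "countable \<B>" unfolding \<B>_def using C(1) by auto
    show "openin Y B" if "B \<in> \<B>" for B using that unfolding \<B>_def Y by auto
    fix F assume F: "finite F" "F \<subseteq> topspace Y"
    then have FM: "F \<subseteq> M" unfolding Y by simp
    \<comment> \<open>The inserted 1 keeps \<open>Min D\<close> defined when \<open>F\<close> has
      fewer than two points.\<close>
    define D where "D = insert 1 ((\<lambda>(x, y). d x y) ` {(x, y) \<in> F \<times> F. x \<noteq> y})"
    have finD: "finite D" unfolding D_def
      using F(1) by (auto intro: finite_subset[of _ "F \<times> F"])
    have "0 < Min D"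
      using finD FM unfolding D_def by (subst Min_gr_iff) (auto simp: D_def subset_iff)
    \<comment> \<open>A common point \<open>z\<close> of two balls would join \<open>x\<close> to
      \<open>y\<close> through \<open>c x\<close>, \<open>z\<close> and \<open>c y\<close> in four
      steps, each shorter than the radius; hence the quarter.\<close>
    then obtain k where k: "inverse (real (Suc k)) < Min D / 4"
      using reals_Archimedean[of "Min D / 4"] by auto
    define r where "r = inverse (real (Suc k))"
    have r: "r > 0" unfolding r_def by simp
    have "\<exists>c\<in>C. x \<in> mball c r" if "x \<in> F" for x
    proof -
      have "x \<in> mtopology closure_of C" using C(3) FM that by auto
      then show ?thesis unfolding metric_closure_of using r FM C(2) by (auto simp: in_mball commute)
    qed
    then obtain c where c: "\<And>x. x \<in> F \<Longrightarrow> c x \<in> C" "\<And>x. x \<in> F \<Longrightarrow> x \<in> mball (c x) r" by metis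
    have "disjnt (mball (c x) r) (mball (c y) r)" if xy: "x \<in> F" "y \<in> F" "x \<noteq> y" for x y
    proof (rule ccontr)
      assume "\<not> disjnt (mball (c x) r) (mball (c y) r)"
      then obtain z where z: "z \<in> mball (c x) r" "z \<in> mball (c y) r" by (auto simp: disjnt_iff)
      have m: "x \<in> M" "y \<in> M" "z \<in> M" "c x \<in> M" "c y \<in> M" using xy FM z c by auto
      have "d x y \<le> d x (c x) + d (c x) z + d z (c y) + d (c y) y"
        using triangle[of x "c x" y] triangle[of "c x" z y] triangle[of z "c y" y] m by linarith
      also have "\<dots> < 4 * r" using z c(2)[OF xy(1)] c(2)[OF xy(2)] commute[of x] commute[of z] by auto
      finally have "d x y < Min D" using k unfolding r_def by simp
      moreover have "d x y \<in> D" unfolding D_def using xy by auto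
      ultimately show False using finD Min_le[of D "d x y"] by linarith
    qed
    then show "\<exists>B. (\<forall>x\<in>F. B x \<in> \<B> \<and> x \<in> B x) \<and> (\<forall>x\<in>F. \<forall>y\<in>F. x \<noteq> y \<longrightarrow> disjnt (B x) (B y))"
      using c by (intro exI[of _ "\<lambda>x. mball (c x) r"]) (auto simp: \<B>_def r_def)
  qed
qed

text \<open>
  The functions \<open>f B x\<close> below are supported near the coordinates of \<open>x\<close>.  Fixing the tuple \<open>B\<close> of
  separating sets keeps these supports apart, so that \<open>f B x\<close> being nonzero at the coordinates
  of \<open>y\<close> places \<open>y\<close> in the box around \<open>x\<close>.
\<close>
lemma hereditarily_Lindelof_power:
  assumes X: "tychonoff_space X"
    and Y: "coarser_topology Y X" "metrizable_space Y" "separable_space Y"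
    and HS: "hereditarily separable_space (Cp X)"
  shows "hereditarily Lindelof_space (power_topology X n)"
  unfolding hereditarily_Lindelof_iff
proof (intro allI impI)
  fix \<W> assume opn: "\<forall>W\<in>\<W>. openin (power_topology X n) W"
  obtain \<B> where \<B>: "countable \<B>" "\<And>B. B \<in> \<B> \<Longrightarrow> openin X B"
    and sep: "\<And>F. \<lbrakk>finite F; F \<subseteq> topspace X\<rbrakk> \<Longrightarrow>
       \<exists>B. (\<forall>x\<in>F. B x \<in> \<B> \<and> x \<in> B x) \<and> (\<forall>x\<in>F. \<forall>y\<in>F. x \<noteq> y \<longrightarrow> disjnt (B x) (B y))"
    using separable_metrizable_separating_family[OF Y(2,3)] Y(1) unfolding coarser_topology_def by metis
  have top: "x i \<in> topspace X" if "x \<in> \<Union>\<W>" "i < n" for x i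
  proof -
    have "x \<in> topspace (power_topology X n)" using that(1) opn openin_subset by blast
    then show ?thesis using that(2) unfolding topspace_power by auto
  qed
  have "\<forall>x\<in>\<Union>\<W>. \<exists>W U. W \<in> \<W> \<and> (\<forall>i<n. openin X (U i) \<and> x i \<in> U i)
      \<and> ({..<n} \<rightarrow>\<^sub>E topspace X) \<inter> {y. \<forall>i<n. y i \<in> U i} \<subseteq> W"
  proof
    fix x assume "x \<in> \<Union>\<W>"
    then obtain W where W: "W \<in> \<W>" "x \<in> W" by blast
    then have "openin (power_topology X n) W" using opn by blast
    from openin_power_contains_box[OF this W(2)] obtain U where "\<forall>i<n. openin X (U i) \<and> x i \<in> U i"
        "({..<n} \<rightarrow>\<^sub>E topspace X) \<inter> {y. \<forall>i<n. y i \<in> U i} \<subseteq> W" .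
    with W(1) show "\<exists>W U. W \<in> \<W> \<and> (\<forall>i<n. openin X (U i) \<and> x i \<in> U i)
        \<and> ({..<n} \<rightarrow>\<^sub>E topspace X) \<inter> {y. \<forall>i<n. y i \<in> U i} \<subseteq> W" by blast
  qed
  then obtain W U where "\<forall>x\<in>\<Union>\<W>. W x \<in> \<W> \<and> (\<forall>i<n. openin X (U x i) \<and> x i \<in> U x i)
      \<and> ({..<n} \<rightarrow>\<^sub>E topspace X) \<inter> {y. \<forall>i<n. y i \<in> U x i} \<subseteq> W x"
    unfolding bchoice_iff by blast
  then have W: "\<And>x. x \<in> \<Union>\<W> \<Longrightarrow> W x \<in> \<W>"
    and U: "\<And>x i. x \<in> \<Union>\<W> \<Longrightarrow> i < n \<Longrightarrow> openin X (U x i)"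
      "\<And>x i. x \<in> \<Union>\<W> \<Longrightarrow> i < n \<Longrightarrow> x i \<in> U x i"
    and sub: "\<And>x. x \<in> \<Union>\<W> \<Longrightarrow> ({..<n} \<rightarrow>\<^sub>E topspace X) \<inter> {y. \<forall>i<n. y i \<in> U x i} \<subseteq> W x"
    by (auto simp del: Union_iff)
  define P where "P B = {x \<in> \<Union>\<W>. \<forall>i<n. x i \<in> B i \<and> (\<forall>j<n. x i = x j \<or> disjnt (B i) (B j))}"
    for B :: "nat \<Rightarrow> 'a set"
  \<comment> \<open>Coordinates of \<open>x\<close> may coincide, so the support near
    \<open>x j\<close> is cut down to the box sides of all indices carrying that same point.\<close>
  define V where "V B x j = topspace X \<inter> \<Inter>(insert (B j) (U x ` {k. k < n \<and> x k = x j}))" for B x j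
  define \<T> where "\<T> = ({..<n} \<rightarrow>\<^sub>E \<B>)"
  define bump where "bump B x f \<longleftrightarrow> f \<in> topspace (Cp X) \<and> (\<forall>i<n. f (x i) = 1) \<and>
      (\<forall>y\<in>topspace X. f y \<noteq> 0 \<longrightarrow> (\<exists>j<n. y \<in> V B x j))" for B x f
  have "\<exists>f. bump B x f"
    if B: "B \<in> \<T>" and x: "x \<in> P B" for B x
  proof -
    have xW: "x \<in> \<Union>\<W>" using x unfolding P_def by blast
    have "openin X (V B x j)" if "j < n" for j
      unfolding V_def using B \<B>(2) U(1)[OF xW] that by (intro openin_Int_Inter) (auto simp: \<T>_def)
    then have "openin X (\<Union>j<n. V B x j)" by auto
    moreover have "x ` {..<n} \<subseteq> (\<Union>j<n. V B x j)"
    proof clarify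
      fix i assume "i < n"
      then have "x i \<in> V B x i"
        unfolding V_def using x top[OF xW] U(2)[OF xW] by (auto simp: P_def) (metis U(2) xW)
      then show "x i \<in> (\<Union>j<n. V B x j)" using \<open>i < n\<close> by blast
    qed
    ultimately obtain \<phi> where \<phi>: "continuous_map X euclideanreal \<phi>" "\<And>y. y \<in> x ` {..<n} \<Longrightarrow> \<phi> y = 1"
        "\<And>y. y \<in> topspace X - (\<Union>j<n. V B x j) \<Longrightarrow> \<phi> y = 0"
      using Cp_bump[OF X, of "x ` {..<n}" "\<Union>j<n. V B x j"] by blast
    have "restrict \<phi> (topspace X) \<in> topspace (Cp X)" using \<phi>(1) by (rule restrict_in_Cp)
    moreover have "\<exists>j<n. y \<in> V B x j" if "y \<in> topspace X" "\<phi> y \<noteq> 0" for y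
      using \<phi>(3)[of y] that by auto
    ultimately show ?thesis
      unfolding bump_def using \<phi>(2) top[OF xW] by (intro exI[of _ "restrict \<phi> (topspace X)"]) auto
  qed
  then obtain f where f: "\<And>B x. B \<in> \<T> \<Longrightarrow> x \<in> P B \<Longrightarrow> bump B x (f B x)"
    by metis
  then have fC: "\<And>B x. B \<in> \<T> \<Longrightarrow> x \<in> P B \<Longrightarrow> f B x \<in> topspace (Cp X)"
    and f1: "\<And>B x i. B \<in> \<T> \<Longrightarrow> x \<in> P B \<Longrightarrow> i < n \<Longrightarrow> f B x (x i) = 1"
    and f0: "\<And>B x y. B \<in> \<T> \<Longrightarrow> x \<in> P B \<Longrightarrow> y \<in> topspace X \<Longrightarrow> f B x y \<noteq> 0 \<Longrightarrow> \<exists>j<n. y \<in> V B x j"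
    unfolding bump_def by simp_all
  have "\<exists>Q\<subseteq>P B. countable Q \<and> f B ` P B \<subseteq> Cp X closure_of (f B ` Q)" if "B \<in> \<T>" for B
  proof -
    have "f B ` P B \<subseteq> topspace (Cp X)" using fC that by blast
    then obtain C where "C \<subseteq> f B ` P B" "countable C" "f B ` P B \<subseteq> Cp X closure_of C"
      using HS unfolding hereditarily_separable_iff by meson
    then show ?thesis by (metis countable_subset_image)
  qed
  then obtain Q where Q: "\<And>B. B \<in> \<T> \<Longrightarrow> Q B \<subseteq> P B" "\<And>B. B \<in> \<T> \<Longrightarrow> countable (Q B)"
      "\<And>B. B \<in> \<T> \<Longrightarrow> f B ` P B \<subseteq> Cp X closure_of (f B ` Q B)"
    by metis
  define \<V> where "\<V> = (\<Union>B\<in>\<T>. W ` Q B)"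
  have PW: "P B \<subseteq> \<Union>\<W>" for B unfolding P_def by blast
  have "\<V> \<subseteq> \<W>" unfolding \<V>_def using Q(1) PW W by blast
  moreover have "countable \<V>"
    unfolding \<V>_def \<T>_def using Q(2) \<B>(1) by (intro countable_UN countable_PiE) (auto simp: \<T>_def)
  moreover have "\<Union>\<W> \<subseteq> \<Union>\<V>"
  proof
    fix y assume y: "y \<in> \<Union>\<W>"
    have ytop: "y ` {..<n} \<subseteq> topspace X" using top[OF y] by auto
    obtain B0 where B0: "\<forall>x\<in>y ` {..<n}. B0 x \<in> \<B> \<and> x \<in> B0 x"
        "\<forall>x\<in>y ` {..<n}. \<forall>x'\<in>y ` {..<n}. x \<noteq> x' \<longrightarrow> disjnt (B0 x) (B0 x')"
      using sep[OF _ ytop] by auto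
    define B where "B = restrict (\<lambda>i. B0 (y i)) {..<n}"
    have B: "B \<in> \<T>" unfolding B_def \<T>_def using B0(1) by auto
    have yP: "y \<in> P B" unfolding P_def B_def using y B0 by auto
    then have "f B y \<in> Cp X closure_of (f B ` Q B)" using Q(3)[OF B] by blast
    moreover have "f B ` Q B \<subseteq> topspace (Cp X)" using Q(1)[OF B] fC[OF B] by blast
    \<comment> \<open>Tolerance 1 is enough: \<open>f B y\<close> is 1 at the coordinates of
      \<open>y\<close>, so \<open>f B x\<close> cannot vanish there.\<close>
    ultimately obtain x where x: "x \<in> Q B" "\<forall>z\<in>y ` {..<n}. \<bar>f B x z - f B y z\<bar> < 1"
      using ytop by (auto simp: in_Cp_closure_of dest!: spec[of _ "y ` {..<n}"] spec[of _ 1])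
    have xP: "x \<in> P B" using x(1) Q(1)[OF B] by blast
    have "y i \<in> U x i" if i: "i < n" for i
    proof -
      have "\<bar>f B x (y i) - f B y (y i)\<bar> < 1" using x(2) i by simp
      then have "f B x (y i) \<noteq> 0" using f1[OF B yP i] by auto
      then obtain j where j: "j < n" "y i \<in> V B x j"
        using f0[OF B xP] ytop i by blast
      then have "y i \<in> B j" unfolding V_def by blast
      moreover have "y i \<in> B i" using yP i unfolding P_def by blast
      ultimately have "\<not> disjnt (B i) (B j)" by (auto simp: disjnt_iff)
      then have "x i = x j" using xP i j(1) unfolding P_def by blast
      then show ?thesis using j(2) i unfolding V_def by auto
    qed
    moreover have "y \<in> ({..<n} \<rightarrow>\<^sub>E topspace X)"
      using y opn openin_subset unfolding topspace_power[symmetric] by blast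
    ultimately have "y \<in> W x" using sub xP PW by blast
    then show "y \<in> \<Union>\<V>" unfolding \<V>_def using B x(1) by blast
  qed
  ultimately show "\<exists>\<V>\<subseteq>\<W>. countable \<V> \<and> \<Union>\<V> = \<Union>\<W>"
    by (metis Union_mono subset_antisym)
qed

section \<open>The eleven equivalent conditions\<close>

theorem theorem2p4:
  fixes X :: "'a topology"
  assumes "tychonoff_space X"
    and "\<exists>Y. coarser_topology Y X \<and> metrizable_space Y \<and> separable_space Y"
  shows "all_equivalent
    [strongly_sequentially_separable (Cp X) \<and> hereditarily sequentially_separable (Cp X),
     hereditarily F_separable (Cp X),
     hereditarily sigma_separable (Cp X),
     strongly_sequentially_separable (Cp X) \<and> hereditarily separable_space (Cp X),
     frechet_urysohn_space (Cp X) \<and> hereditarily separable_space (Cp X),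
     gamma_space X \<and> (\<forall>n>0. perfectly_normal_space (power_topology X n)),
     gamma_space X \<and> (\<forall>n>0. hereditarily Lindelof_space (power_topology X n)),
     gamma_space X \<and> perfectly_normal_space (omega_power_topology X),
     gamma_space X \<and> hereditarily Lindelof_space (omega_power_topology X),
     gamma_space X \<and> hereditarily normal_space (omega_power_topology X),
     gamma_space X \<and> hereditarily countably_paracompact_space (omega_power_topology X)]"
  (is "all_equivalent [?A1, ?A2, ?A3, ?A4, ?A5, ?A6, ?A7, ?A8, ?A9, ?A10, ?A11]")
proof -
  obtain Y where Y: "coarser_topology Y X" "metrizable_space Y" "separable_space Y"
    using assms(2) by blast
  have t1: "t1_space X" and reg: "regular_space X"
    using assms(1) unfolding tychonoff_space_def
    by (auto intro: Hausdorff_imp_t1_space completely_regular_imp_regular_space)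
  have regP: "regular_space (power_topology X n)" and regO: "regular_space (omega_power_topology X)" for n
    unfolding power_topology_def omega_power_topology_def using reg by (auto simp: regular_space_product_topology)
  \<comment> \<open>The implications close up as 5 - 1 - 4 - 7 - 5 and 5 - 2 - 3 - 5. Condition 7 is
    equivalent to 6 and gives 9, which gives 8, 10 and 11; each of these three returns to 7.\<close>
  have 1: "?A1" if "?A5"
    using that frechet_urysohn_separable frechet_urysohn_subtopology hereditarily_imp
    unfolding hereditarily_def by (metis subtopology_topspace order_refl)
  have 2: "?A2" if "?A5"
    using that frechet_urysohn_separable(3) frechet_urysohn_subtopology unfolding hereditarily_def by metis
  have 3: "?A3" if "?A2"
    using that F_separable_imp_sigma_separable unfolding hereditarily_def by metis
  have 4: "?A4" if "?A1"
    using that sequentially_separable_imp_separable unfolding hereditarily_def by metis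
  have 5: "?A5" if "?A3"
    using that hereditarily_sigma_separable_imp_frechet_urysohn[OF Hausdorff_imp_t1_space[OF Hausdorff_Cp]]
      sigma_separable_imp_separable unfolding hereditarily_def by metis
  have 6: "?A7" if "?A4"
    using that strongly_sequentially_separable_imp_gamma_space[OF assms(1)] hereditarily_Lindelof_power[OF assms(1) Y]
    by blast
  have 7: "?A5" if "?A7"
  proof -
    have "hereditarily Lindelof_space (power_topology X n)" for n
      using that hereditarily_Lindelof_power_0 by (cases "n = 0") auto
    then show ?thesis
      using that gamma_space_imp_frechet_urysohn[OF t1] hereditarily_separable_Cp by blast
  qed
  have 8: "?A6" if "?A7"
    using that regular_hereditarily_Lindelof_imp_perfectly_normal regP by blast
  have 9: "?A9" if "?A7"
    using that hereditarily_Lindelof_omega_power by blast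
  have sub: "regular_space (subtopology (omega_power_topology X) S)
      \<and> hereditarily Lindelof_space (subtopology (omega_power_topology X) S)"
    if "?A9" "S \<subseteq> topspace (omega_power_topology X)" for S
    using that regO regular_space_subtopology hereditarily_hereditarily by blast
  have 10: "?A8 \<and> ?A10 \<and> ?A11" if "?A9"
    using that sub[OF that] regular_hereditarily_Lindelof_imp_perfectly_normal[OF regO]
      regular_hereditarily_Lindelof_imp_perfectly_normal regular_hereditarily_Lindelof_imp_countably_paracompact
    unfolding hereditarily_def[of normal_space] hereditarily_def[of countably_paracompact_space]
      perfectly_normal_space_def
    by blast
  have key: "?A7" if "gamma_space X" "\<And>n C. n > 0 \<Longrightarrow> closedin (power_topology X n) C \<Longrightarrow> gdelta_in (power_topology X n) C"
    using that Lindelof_perfect_imp_hereditarily_Lindelof gamma_space_imp_Lindelof_power by blast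
  have 11: "?A7" if "?A6"
    using that key unfolding perfectly_normal_space_def by blast
  have 12: "?A7" if "?A8"
    using that key power_closed_gdelta_omega unfolding perfectly_normal_space_def by blast
  have 13: "?A7" if "?A10 \<or> ?A11"
    using that key power_closed_gdelta[OF t1] by blast
  have eq: "?A1 = ?A7" "?A2 = ?A7" "?A3 = ?A7" "?A4 = ?A7" "?A5 = ?A7" "?A6 = ?A7" "?A8 = ?A7"
      "?A9 = ?A7" "?A10 = ?A7" "?A11 = ?A7"
    using 1 2 3 4 5 6 7 8 9 10 11 12 13 by blast+
  show ?thesis
    unfolding eq all_equivalent_def by simp
qed

end
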